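(* Let $n\ge3$ and $d\ge2$. The order of $\mathbb{T}_n^d$ equals $|\mathbb{R}_d|\cdot|\mathbb{F}_n|$.
   Context: Let $[n]=\{0,\dots,n-1\}$; the cube $n^d$ is $[n]^d$. A set of $n$ distinct points is a line if it can be ordered $(q^1,\dots,q^n)$ such that in each coordinate the sequence of values is strictly increasing, strictly decreasing or constant, with at least one coordinate non-constant. $\mathbb{T}_n^d$ is the group of permutations of $[n]^d$ mapping lines onto lines. $\mathbb{R}_d$ is the group generated by the maps $R_{ij}$ ($i\ne j$), where $R_{ij}([x_1,\dots,x_d])$ has $i$-th coordinate $n-x_j-1$, $j$-th coordinate $x_i$, and other coordinates unchanged. $\mathbb{F}_n$ is the group of maps $F_\pi([x_1,\dots,x_d])=[\pi(x_1),\dots,\pi(x_d)]$ for permutations $\pi$ of $[n]$ with $\pi(n-p-1)=n-\pi(p)-1$ for all $p$. *)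

theory Defs
  imports "HOL-Algebra.Bij" "HOL-Algebra.Generated_Groups" "HOL-Combinatorics.Permutations"
begin

text \<open>A point \<open>[x\<^sub>1, \<dots>, x\<^sub>d]\<close> is a function on the index set \<open>{1..d}\<close>, extensional outside of it,
  so that distinct functions are distinct points.\<close>

definition cube :: "nat \<Rightarrow> nat \<Rightarrow> (nat \<Rightarrow> nat) set" where
  "cube n d = {1..d} \<rightarrow>\<^sub>E {..<n}"

definition is_line :: "nat \<Rightarrow> nat \<Rightarrow> (nat \<Rightarrow> nat) set \<Rightarrow> bool" where
  "is_line n d L \<longleftrightarrow> L \<subseteq> cube n d \<and>
     (\<exists>q. bij_betw q {1..n} L \<and>
        (\<forall>i\<in>{1..d}. strict_mono_on {1..n} (\<lambda>k. q k i) \<or>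
                    strict_antimono_on {1..n} (\<lambda>k. q k i) \<or>
                    (\<exists>c. \<forall>k\<in>{1..n}. q k i = c)) \<and>
        (\<exists>i\<in>{1..d}. \<not> (\<exists>c. \<forall>k\<in>{1..n}. q k i = c)))"

definition line_group :: "nat \<Rightarrow> nat \<Rightarrow> ((nat \<Rightarrow> nat) \<Rightarrow> nat \<Rightarrow> nat) monoid" where
  "line_group n d = BijGroup (cube n d)
     \<lparr>carrier := {f \<in> Bij (cube n d). \<forall>L. is_line n d L \<longrightarrow> is_line n d (f ` L)}\<rparr>"

definition rot :: "nat \<Rightarrow> nat \<Rightarrow> nat \<Rightarrow> nat \<Rightarrow> (nat \<Rightarrow> nat) \<Rightarrow> nat \<Rightarrow> nat" where
  "rot n d i j = (\<lambda>x\<in>cube n d. x(i := n - x j - 1, j := x i))"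

definition rot_group :: "nat \<Rightarrow> nat \<Rightarrow> ((nat \<Rightarrow> nat) \<Rightarrow> nat \<Rightarrow> nat) monoid" where
  "rot_group n d = BijGroup (cube n d)
     \<lparr>carrier := generate (BijGroup (cube n d))
        {rot n d i j | i j. i \<in> {1..d} \<and> j \<in> {1..d} \<and> i \<noteq> j}\<rparr>"

definition coord_map :: "nat \<Rightarrow> nat \<Rightarrow> (nat \<Rightarrow> nat) \<Rightarrow> (nat \<Rightarrow> nat) \<Rightarrow> nat \<Rightarrow> nat" where
  "coord_map n d \<pi> = (\<lambda>x\<in>cube n d. \<lambda>i\<in>{1..d}. \<pi> (x i))"

definition sym_perms :: "nat \<Rightarrow> (nat \<Rightarrow> nat) set" where
  "sym_perms n = {\<pi>. \<pi> permutes {..<n} \<and> (\<forall>p<n. \<pi> (n - p - 1) = n - \<pi> p - 1)}"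

definition coord_group :: "nat \<Rightarrow> nat \<Rightarrow> ((nat \<Rightarrow> nat) \<Rightarrow> nat \<Rightarrow> nat) monoid" where
  "coord_group n d = BijGroup (cube n d) \<lparr>carrier := coord_map n d ` sym_perms n\<rparr>"


subsection \<open>These structures are groups\<close>

lemma finite_cube: "finite (cube n d)"
  by (simp add: cube_def finite_PiE)

lemma group_line_group: "group (line_group n d)"
proof -
  let ?S = "cube n d"
  let ?T = "{f \<in> Bij ?S. \<forall>L. is_line n d L \<longrightarrow> is_line n d (f ` L)}"
  have sub: "L \<subseteq> ?S" if "is_line n d L" for L
    using that by (simp add: is_line_def)
  have comp_im: "compose ?S f g ` L = f ` g ` L" if "L \<subseteq> ?S" for f g L
    using that by (auto simp: compose_def image_iff subset_iff)
  have "subgroup ?T (BijGroup ?S)"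
  proof (rule subgroup.intro)
    show "?T \<subseteq> carrier (BijGroup ?S)" by (auto simp: BijGroup_def)
  next
    fix f g assume "f \<in> ?T" "g \<in> ?T"
    then show "f \<otimes>\<^bsub>BijGroup ?S\<^esub> g \<in> ?T"
      by (auto simp: BijGroup_def compose_Bij comp_im sub)
  next
    have "(\<lambda>x\<in>?S. x) ` L = L" if "L \<subseteq> ?S" for L
      using that by (auto simp: image_iff subset_iff)
    then show "\<one>\<^bsub>BijGroup ?S\<^esub> \<in> ?T"
      by (auto simp: BijGroup_def id_Bij sub)
  next
    fix f assume f: "f \<in> ?T"
    then have bij: "bij_betw f ?S ?S" by (simp add: Bij_def)
    let ?L = "{L. is_line n d L}"
    have fin: "finite ?L"
      by (rule finite_subset[of _ "Pow ?S"]) (auto simp: finite_cube dest: sub)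
    have inj: "inj_on (image f) ?L"
      using bij sub by (intro inj_onI) (metis bij_betw_def inj_on_image_eq_iff mem_Collect_eq)
    have "image f ` ?L = ?L"
      using f by (intro endo_inj_surj[OF fin _ inj]) auto
    then have ex: "\<exists>K. is_line n d K \<and> L = f ` K" if "is_line n d L" for L
      using that by (metis (mono_tags, lifting) imageE mem_Collect_eq)
    have inv_im: "restrict (inv_into ?S f) ?S ` f ` K = K" if "K \<subseteq> ?S" for K
    proof -
      have "restrict (inv_into ?S f) ?S (f x) = x" if "x \<in> K" for x
        using that \<open>K \<subseteq> ?S\<close> bij by (auto simp: bij_betw_def)
      then show ?thesis unfolding image_image by (simp del: restrict_apply cong: image_cong)
    qed
    have "is_line n d (restrict (inv_into ?S f) ?S ` L)" if "is_line n d L" for L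
      using ex[OF that] inv_im sub by metis
    then show "inv\<^bsub>BijGroup ?S\<^esub> f \<in> ?T"
      using f by (simp add: inv_BijGroup restrict_inv_into_Bij)
  qed
  then show ?thesis
    unfolding line_group_def by (rule group.subgroup_imp_group[OF group_BijGroup])
qed

lemma rot_in_Bij:
  assumes "i \<in> {1..d}" "j \<in> {1..d}" "i \<noteq> j"
  shows "rot n d i j \<in> Bij (cube n d)"
proof -
  have maps: "rot n d i j ` cube n d \<subseteq> cube n d"
  proof (rule image_subsetI)
    fix x assume x: "x \<in> cube n d"
    then have "x j < n" "x i < n" using assms by (auto simp: cube_def)
    with x show "rot n d i j x \<in> cube n d"
      using assms by (auto simp: rot_def cube_def PiE_iff extensional_def)
  qed
  have inj: "inj_on (rot n d i j) (cube n d)"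
  proof (rule inj_onI)
    fix x y assume x: "x \<in> cube n d" and y: "y \<in> cube n d"
      and eq: "rot n d i j x = rot n d i j y"
    have bnd: "x j < n" "y j < n" using x y assms by (auto simp: cube_def)
    have E: "(x(i := n - x j - 1, j := x i)) k = (y(i := n - y j - 1, j := y i)) k" for k
      using eq x y by (simp add: rot_def fun_eq_iff)
    have "x i = y i" using E[of j] by simp
    moreover have "x j = y j" using E[of i] assms(3) bnd by simp
    moreover have "x k = y k" if "k \<noteq> i" "k \<noteq> j" for k using E[of k] that by simp
    ultimately show "x = y" by (metis ext)
  qed
  have "rot n d i j ` cube n d = cube n d"
    by (rule endo_inj_surj[OF finite_cube maps inj])
  with inj show ?thesis
    by (simp add: Bij_def bij_betw_def) (simp add: rot_def)
qed

lemma group_rot_group: "group (rot_group n d)"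
proof -
  have "{rot n d i j | i j. i \<in> {1..d} \<and> j \<in> {1..d} \<and> i \<noteq> j} \<subseteq> carrier (BijGroup (cube n d))"
    using rot_in_Bij by (auto simp: BijGroup_def)
  from group.generate_is_subgroup[OF group_BijGroup this] show ?thesis
    unfolding rot_group_def by (rule group.subgroup_imp_group[OF group_BijGroup])
qed

lemma coord_map_id: "coord_map n d id = (\<lambda>x\<in>cube n d. x)"
proof
  fix x
  show "coord_map n d id x = (\<lambda>x\<in>cube n d. x) x"
    by (auto simp: coord_map_def cube_def)
qed

lemma coord_map_in_cube:
  "\<pi> permutes {..<n} \<Longrightarrow> x \<in> cube n d \<Longrightarrow> coord_map n d \<pi> x \<in> cube n d"
  by (auto simp: coord_map_def cube_def PiE_iff permutes_in_image[of \<pi> "{..<n}", unfolded lessThan_iff])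

lemma coord_map_comp:
  assumes "\<sigma> permutes {..<n}"
  shows "compose (cube n d) (coord_map n d \<pi>) (coord_map n d \<sigma>) = coord_map n d (\<pi> \<circ> \<sigma>)"
proof
  fix x
  show "compose (cube n d) (coord_map n d \<pi>) (coord_map n d \<sigma>) x = coord_map n d (\<pi> \<circ> \<sigma>) x"
    using coord_map_in_cube[OF assms, of x d]
    by (auto simp: compose_def coord_map_def fun_eq_iff)
qed

lemma coord_map_in_Bij:
  assumes p: "\<pi> permutes {..<n}"
  shows "coord_map n d \<pi> \<in> Bij (cube n d)"
proof -
  let ?S = "cube n d"
  have q: "inv_into UNIV \<pi> permutes {..<n}" using p by (rule permutes_inv)
  have a: "compose ?S (coord_map n d (inv_into UNIV \<pi>)) (coord_map n d \<pi>) = (\<lambda>x\<in>?S. x)"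
    using coord_map_comp[OF p] p by (simp add: permutes_inv_o coord_map_id)
  have b: "compose ?S (coord_map n d \<pi>) (coord_map n d (inv_into UNIV \<pi>)) = (\<lambda>x\<in>?S. x)"
    using coord_map_comp[OF q] p by (simp add: permutes_inv_o coord_map_id)
  have "bij_betw (coord_map n d \<pi>) ?S ?S"
  proof (rule bij_betw_byWitness[where f' = "coord_map n d (inv_into UNIV \<pi>)"])
    show "\<forall>x\<in>?S. coord_map n d (inv_into UNIV \<pi>) (coord_map n d \<pi> x) = x"
      using fun_cong[OF a] by (metis compose_eq restrict_apply')
    show "\<forall>x\<in>?S. coord_map n d \<pi> (coord_map n d (inv_into UNIV \<pi>) x) = x"
      using fun_cong[OF b] by (metis compose_eq restrict_apply')
  qed (use coord_map_in_cube p q in auto)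
  then show ?thesis by (simp add: Bij_def) (simp add: coord_map_def)
qed

lemma sym_perms_comp: "\<pi> \<in> sym_perms n \<Longrightarrow> \<sigma> \<in> sym_perms n \<Longrightarrow> \<pi> \<circ> \<sigma> \<in> sym_perms n"
  unfolding sym_perms_def
  by (auto intro: permutes_compose) (metis lessThan_iff permutes_in_image)

lemma sym_perms_inv:
  assumes "\<pi> \<in> sym_perms n"
  shows "inv_into UNIV \<pi> \<in> sym_perms n"
proof -
  from assms have p: "\<pi> permutes {..<n}"
    and s: "\<And>p. p < n \<Longrightarrow> \<pi> (n - p - 1) = n - \<pi> p - 1"
    by (auto simp: sym_perms_def)
  have "inv_into UNIV \<pi> (n - k - 1) = n - inv_into UNIV \<pi> k - 1" if "k < n" for k
  proof -
    have "inv_into UNIV \<pi> k < n"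
      using that permutes_in_image[OF permutes_inv[OF p], of k] by simp
    from s[OF this] have "\<pi> (n - inv_into UNIV \<pi> k - 1) = n - k - 1"
      using permutes_inverses(1)[OF p] by simp
    then show ?thesis using permutes_inverses(2)[OF p] by metis
  qed
  then show ?thesis using permutes_inv[OF p] by (simp add: sym_perms_def)
qed

lemma group_coord_group: "group (coord_group n d)"
proof -
  let ?S = "cube n d" and ?F = "coord_map n d ` sym_perms n"
  have perm: "\<pi> permutes {..<n}" if "\<pi> \<in> sym_perms n" for \<pi>
    using that by (simp add: sym_perms_def)
  have mult: "coord_map n d \<pi> \<otimes>\<^bsub>BijGroup ?S\<^esub> coord_map n d \<sigma> = coord_map n d (\<pi> \<circ> \<sigma>)"
    if "\<pi> \<in> sym_perms n" "\<sigma> \<in> sym_perms n" for \<pi> \<sigma>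
    using that by (simp add: BijGroup_def coord_map_in_Bij coord_map_comp perm)
  have id: "id \<in> sym_perms n" by (simp add: sym_perms_def permutes_id)
  have one: "\<one>\<^bsub>BijGroup ?S\<^esub> = coord_map n d id"
    by (simp add: BijGroup_def coord_map_id)
  have carr: "coord_map n d \<pi> \<in> carrier (BijGroup ?S)" if "\<pi> \<in> sym_perms n" for \<pi>
    using coord_map_in_Bij[OF perm[OF that]] by (simp add: BijGroup_def)
  have "subgroup ?F (BijGroup ?S)"
  proof (rule subgroup.intro)
    show "?F \<subseteq> carrier (BijGroup ?S)" using carr by auto
    show "f \<otimes>\<^bsub>BijGroup ?S\<^esub> g \<in> ?F" if "f \<in> ?F" "g \<in> ?F" for f g
      using that mult sym_perms_comp by auto
    show "\<one>\<^bsub>BijGroup ?S\<^esub> \<in> ?F" using one id by auto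
  next
    fix f assume "f \<in> ?F"
    then obtain \<pi> where \<pi>: "\<pi> \<in> sym_perms n" "f = coord_map n d \<pi>" by auto
    have "coord_map n d (inv_into UNIV \<pi>) \<otimes>\<^bsub>BijGroup ?S\<^esub> f = \<one>\<^bsub>BijGroup ?S\<^esub>"
      using \<pi> mult[OF sym_perms_inv[OF \<pi>(1)] \<pi>(1)] perm[OF \<pi>(1)]
      by (simp add: one permutes_inv_o)
    then have "inv\<^bsub>BijGroup ?S\<^esub> f = coord_map n d (inv_into UNIV \<pi>)"
      using \<pi> carr sym_perms_inv by (intro group.inv_equality[OF group_BijGroup]) auto
    then show "inv\<^bsub>BijGroup ?S\<^esub> f \<in> ?F" using sym_perms_inv[OF \<pi>(1)] by auto
  qed
  then show ?thesis
    unfolding coord_group_def by (rule group.subgroup_imp_group[OF group_BijGroup])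
qed

end

theory Submission
  imports Defs
begin

text \<open>
  Write \<open>rv t = n - 1 - t\<close>. A bijection preserving lines preserves collinearity, hence the number of
  transversals of two lines \<open>L, M\<close> through a point \<open>P\<close>, that is of pairs of collinear points of
  \<open>L - {P}\<close> and \<open>M - {P}\<close>. This number avoids 0 and 2 for all \<open>L \<noteq> M\<close> through \<open>P\<close> exactly when all
  coordinates of \<open>P\<close> lie in one pair \<open>{a, rv a}\<close> with \<open>a \<noteq> rv a\<close>, i.e. when \<open>P\<close> is a noncentral point of
  a main diagonal. So main diagonals are mapped to main diagonals, and after composing with reflections
  of coordinates and a map \<open>F\<^sub>\<pi>\<close> the line \<open>x\<^sub>1 = \<dots> = x\<^sub>d\<close> is fixed pointwise. The induced map on the
  corners, seen as subsets of the index set, is then an automorphism of the inclusion order, so a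
  permutation of the coordinates makes all corners fixed. Finally, a map fixing the corners and the line
  \<open>x\<^sub>1 = \<dots> = x\<^sub>d\<close> is the identity, by induction on the number of pairs \<open>{a, rv a}\<close> met by the
  coordinates of a point.

  Consequently every element of the group is \<open>x \<mapsto> (\<plusminus> \<pi> (x (s i)))\<^sub>i\<close>, uniquely so if the sign at
  coordinate 1 is positive, while the rotations are those with \<open>\<pi> = id\<close> and an even number of signs
  if \<open>s\<close> is even, an odd number if \<open>s\<close> is odd; forgetting the sign at coordinate 1 thus identifies
  the rotations with the pairs of a permutation and a sign vector on the other coordinates.
\<close>

section \<open>Symmetric differences and automorphisms of a power set\<close>

definition sdiff :: "'a set \<Rightarrow> 'a set \<Rightarrow> 'a set" where
  "sdiff A B = (A - B) \<union> (B - A)"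

text \<open>The common part of \<open>A\<close> and \<open>B\<close> is counted twice in the sum of
  the two cardinalities. This makes the parity of the number of signs additive when signed
  permutations are composed.\<close>

lemma even_card_sdiff:
  assumes "finite A" "finite B"
  shows "even (card (sdiff A B)) \<longleftrightarrow> even (card A) = even (card B)"
proof -
  have "card (sdiff A B) = card (A - B) + card (B - A)"
    unfolding sdiff_def using assms by (intro card_Un_disjoint) auto
  moreover have "card A = card (A - B) + card (A \<inter> B)" "card B = card (B - A) + card (A \<inter> B)"
    using assms card_Int_Diff[of A B] card_Int_Diff[of B A] by (auto simp: Int_commute)
  ultimately show ?thesis by presburger
qed

text \<open>Comparability seen from the empty set says that \<open>A\<close> and \<open>B\<close>
  are nested. Seen from \<open>A\<close>, it says that \<open>B\<close> is contained in
  \<open>A\<close> or disjoint from it, and disjointness rules out that a nonempty \<open>A\<close>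
  lies properly inside \<open>B\<close>. Thus inclusion is recovered from comparability
  alone.\<close>

lemma subset_by_comparability:
  assumes "A \<noteq> {}"
  shows "B \<subseteq> A \<longleftrightarrow> (sdiff {} B \<subseteq> sdiff {} A \<or> sdiff {} A \<subseteq> sdiff {} B) \<and>
    (sdiff A {} \<subseteq> sdiff A B \<or> sdiff A B \<subseteq> sdiff A {})"
  using assms by (auto simp: sdiff_def)

lemma three_subset_card: "finite T \<Longrightarrow> {x, y, z} \<subseteq> T \<Longrightarrow> x \<noteq> y \<Longrightarrow> x \<noteq> z \<Longrightarrow> y \<noteq> z \<Longrightarrow> card T \<ge> 3"
  using card_mono[of T "{x, y, z}"] by simp

text \<open>The empty set is the least element and the singletons are the minimal nonempty sets, so
  \<open>phi\<close> permutes the singletons; membership is inclusion of a singleton, which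
  determines \<open>phi\<close> on all subsets.\<close>

lemma order_automorphism_Pow:
  fixes phi :: "'a set \<Rightarrow> 'a set"
  assumes bij: "bij_betw phi (Pow S) (Pow S)"
    and mono: "\<And>A B. A \<subseteq> S \<Longrightarrow> B \<subseteq> S \<Longrightarrow> phi A \<subseteq> phi B \<longleftrightarrow> A \<subseteq> B"
  obtains \<sigma> where "bij_betw \<sigma> S S" "\<And>A. A \<subseteq> S \<Longrightarrow> phi A = \<sigma> ` A"
proof -
  have surj: "\<exists>A\<subseteq>S. phi A = B" if "B \<subseteq> S" for B
  proof -
    have "B \<in> phi ` Pow S" using bij that by (simp add: bij_betw_def)
    then show ?thesis by blast
  qed
  have im: "phi A \<subseteq> S" if "A \<subseteq> S" for A using bij that by (auto simp: bij_betw_def)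
  have emp: "phi {} = {}" using surj[of "{}"] mono[of "{}"] by auto
  have ex: "\<exists>j\<in>S. phi {i} = {j}" if i: "i \<in> S" for i
  proof -
    have "phi {i} \<noteq> {}" using mono[of "{i}" "{}"] i emp by auto
    then obtain j where j: "j \<in> phi {i}" by blast
    then have jS: "j \<in> S" using im[of "{i}"] i by auto
    obtain A where A: "A \<subseteq> S" "phi A = {j}" using surj[of "{j}"] jS by auto
    have "A \<subseteq> {i}" using mono[of A "{i}"] A j i by auto
    moreover have "A \<noteq> {}" using A emp by auto
    ultimately show ?thesis using A jS by (metis subset_singletonD)
  qed
  define \<sigma> where "\<sigma> i = the_elem (phi {i})" for i
  have \<sigma>: "phi {i} = {\<sigma> i}" "\<sigma> i \<in> S" if i: "i \<in> S" for i
  proof -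
    obtain j where j: "j \<in> S" "phi {i} = {j}" using ex[OF i] by blast
    then have "\<sigma> i = j" by (simp add: \<sigma>_def)
    then show "phi {i} = {\<sigma> i}" "\<sigma> i \<in> S" using j by simp_all
  qed
  have onto: "\<exists>i\<in>S. \<sigma> i = j" if j: "j \<in> S" for j
  proof -
    obtain A where A: "A \<subseteq> S" "phi A = {j}" using surj[of "{j}"] j by auto
    then have "A \<noteq> {}" using emp by auto
    then obtain i where i: "i \<in> A" by blast
    then have "phi {i} \<subseteq> {j}" using mono[of "{i}" A] A by auto
    then show ?thesis using \<sigma>[of i] i A by auto
  qed
  have mem: "\<sigma> i \<in> phi A \<longleftrightarrow> i \<in> A" if "i \<in> S" "A \<subseteq> S" for i A
    using mono[of "{i}" A] \<sigma>[OF that(1)] that by auto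
  have "phi A = \<sigma> ` A" if A: "A \<subseteq> S" for A
  proof
    show "phi A \<subseteq> \<sigma> ` A"
    proof
      fix j assume j: "j \<in> phi A"
      then obtain i where "i \<in> S" "\<sigma> i = j" using onto im[OF A] by blast
      then show "j \<in> \<sigma> ` A" using mem[of i A] A j by auto
    qed
    show "\<sigma> ` A \<subseteq> phi A" using mem A by auto
  qed
  moreover have "bij_betw \<sigma> S S"
  proof -
    have "inj_on \<sigma> S"
    proof (rule inj_onI)
      fix i j assume "i \<in> S" "j \<in> S" "\<sigma> i = \<sigma> j"
      then show "i = j" using mem[of i "{j}"] \<sigma>(1)[of j] by auto
    qed
    then show ?thesis using onto \<sigma> by (auto simp: bij_betw_def)
  qed
  ultimately show thesis using that by blast
qed

subsection \<open>Lines and collinearity\<close>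

locale cube_lines =
  fixes n d :: nat
  assumes n3: "n \<ge> 3" and d2: "d \<ge> 2"
begin

declare One_nat_def [simp del]

abbreviation C :: "(nat \<Rightarrow> nat) set" where "C \<equiv> cube n d"
abbreviation I :: "nat set" where "I \<equiv> {1..d}"
abbreviation line :: "(nat \<Rightarrow> nat) set \<Rightarrow> bool" where "line \<equiv> is_line n d"

definition rv :: "nat \<Rightarrow> nat" where "rv t = n - 1 - t"

lemma rv_less [simp]: "rv t < n"
  using n3 by (auto simp: rv_def)

lemma rv_rv [simp]: "t < n \<Longrightarrow> rv (rv t) = t"
  by (auto simp: rv_def)

lemma rv_inj: "s < n \<Longrightarrow> t < n \<Longrightarrow> rv s = rv t \<longleftrightarrow> s = t"
  by (auto simp: rv_def)

text \<open>A set \<open>A\<close> of coordinates serves as a sign vector: the values are reversed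
  exactly at its members. Each \<open>sg A i\<close> is an involution of the values below
  \<open>n\<close>.\<close>

definition sg :: "nat set \<Rightarrow> nat \<Rightarrow> nat \<Rightarrow> nat" where
  "sg A i t = (if i \<in> A then rv t else t)"

lemma sg_less [simp]: "t < n \<Longrightarrow> sg A i t < n"
  by (simp add: sg_def)

lemma sg_inj: "s < n \<Longrightarrow> t < n \<Longrightarrow> sg A i s = sg A i t \<longleftrightarrow> s = t"
  by (simp add: sg_def rv_inj)

lemma sg_sg [simp]: "t < n \<Longrightarrow> sg A i (sg A i t) = t"
  by (simp add: sg_def)

text \<open>\<open>lp x S A ` {..<n}\<close> is the line with active coordinates \<open>S\<close>, of which those in \<open>A\<close> decrease;
  the other coordinates are those of \<open>x\<close>.\<close>

definition lp :: "(nat \<Rightarrow> nat) \<Rightarrow> nat set \<Rightarrow> nat set \<Rightarrow> nat \<Rightarrow> nat \<Rightarrow> nat" where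
  "lp x S A t = (\<lambda>i. if i \<in> S then sg A i t else x i)"

lemma C_less: "x \<in> C \<Longrightarrow> i \<in> I \<Longrightarrow> x i < n"
  by (auto simp: cube_def)

lemma C_ext: "x \<in> C \<Longrightarrow> y \<in> C \<Longrightarrow> (\<And>i. i \<in> I \<Longrightarrow> x i = y i) \<Longrightarrow> x = y"
  unfolding cube_def by (rule PiE_ext)

lemma C_neq: "x \<in> C \<Longrightarrow> y \<in> C \<Longrightarrow> x \<noteq> y \<Longrightarrow> \<exists>i\<in>I. x i \<noteq> y i"
  using C_ext by blast

lemma restrict_in_C: "(\<And>i. i \<in> I \<Longrightarrow> h i < n) \<Longrightarrow> (\<lambda>i\<in>I. h i) \<in> C"
  by (auto simp: cube_def)

lemma lp_in_C: "x \<in> C \<Longrightarrow> S \<subseteq> I \<Longrightarrow> t < n \<Longrightarrow> lp x S A t \<in> C"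
  by (auto simp: cube_def lp_def PiE_iff extensional_def)

text \<open>There is no room for gaps among \<open>n\<close> increasing values below
  \<open>n\<close>: induction from the lower end bounds \<open>h\<close> from below, induction from
  the upper end bounds it from above, and the bounds meet.\<close>

lemma strict_mono_on_onto_lessThan:
  fixes h :: "nat \<Rightarrow> nat"
  assumes "strict_mono_on {1..n} h" and "\<And>k. k \<in> {1..n} \<Longrightarrow> h k < n" and "k \<in> {1..n}"
  shows "h k = k - 1"
proof -
  have step: "h i < h j" if "1 \<le> i" "i < j" "j \<le> n" for i j
    using assms(1) that by (auto simp: strict_mono_on_def)
  have lo: "j \<le> h (Suc j)" if "Suc j \<le> n" for j
    using that
  proof (induction j)
    case (Suc j)
    then show ?case using step[of "Suc j" "Suc (Suc j)"] by simp
  qed simp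
  have hi: "h (n - j) + j < n" if "j < n" for j
    using that
  proof (induction j)
    case 0
    then show ?case using assms(2)[of n] by simp
  next
    case (Suc j)
    then have "h (n - Suc j) < h (n - j)" by (intro step) auto
    then show ?case using Suc by simp
  qed
  show ?thesis using lo[of "k - 1"] hi[of "n - k"] assms(3) by auto
qed

lemma strict_antimono_on_onto_lessThan:
  fixes h :: "nat \<Rightarrow> nat"
  assumes "strict_antimono_on {1..n} h" and "\<And>k. k \<in> {1..n} \<Longrightarrow> h k < n" and "k \<in> {1..n}"
  shows "h k = rv (k - 1)"
proof -
  have "strict_mono_on {1..n} (\<lambda>k. rv (h k))"
  proof (rule strict_mono_onI)
    fix r s assume rs: "r \<in> {1..n}" "s \<in> {1..n}" "r < s"
    then have "h s < h r" using assms(1) by (auto simp: monotone_on_def)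
    then show "rv (h r) < rv (h s)" using assms(2)[OF rs(1)] by (auto simp: rv_def)
  qed
  then have "rv (h k) = k - 1"
    by (rule strict_mono_on_onto_lessThan) (use assms(3) in auto)
  then show ?thesis using assms by (metis rv_rv)
qed

text \<open>Normal form for lines. A nonconstant coordinate takes \<open>n\<close> monotone values
  below \<open>n\<close>, hence runs through all of them in order or in reverse; the index range 1
  to \<open>n\<close> is shifted to parameters 0 to \<open>n - 1\<close>.\<close>

lemma line_iff: "line L \<longleftrightarrow> (\<exists>x S A. x \<in> C \<and> S \<subseteq> I \<and> S \<noteq> {} \<and> L = lp x S A ` {..<n})"
proof
  assume L: "line L"
  then obtain q where sub: "L \<subseteq> C" and q: "bij_betw q {1..n} L"
    and alt: "\<And>i. i \<in> I \<Longrightarrow> strict_mono_on {1..n} (\<lambda>k. q k i) \<or>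
                    strict_antimono_on {1..n} (\<lambda>k. q k i) \<or> (\<exists>c. \<forall>k\<in>{1..n}. q k i = c)"
    and nc: "\<exists>i\<in>I. \<not> (\<exists>c. \<forall>k\<in>{1..n}. q k i = c)"
    unfolding is_line_def by blast
  have qC: "q k \<in> C" if "k \<in> {1..n}" for k
    using that q sub by (auto simp: bij_betw_def)
  define S where "S = {i \<in> I. \<not> (\<exists>c. \<forall>k\<in>{1..n}. q k i = c)}"
  define A where "A = {i. \<not> strict_mono_on {1..n} (\<lambda>k. q k i)}"
  have *: "q k = lp (q 1) S A (k - 1)" if k: "k \<in> {1..n}" for k
  proof (rule C_ext)
    have "q 1 \<in> C" using qC n3 by simp
    then show "lp (q 1) S A (k - 1) \<in> C" using k by (intro lp_in_C) (auto simp: S_def)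
    show "q k i = lp (q 1) S A (k - 1) i" if i: "i \<in> I" for i
    proof (cases "i \<in> S")
      case False
      then obtain c where "\<forall>k\<in>{1..n}. q k i = c" using i by (auto simp: S_def)
      then show ?thesis using k False n3 by (auto simp: lp_def)
    next
      case True
      have less: "\<And>k. k \<in> {1..n} \<Longrightarrow> q k i < n" using qC C_less i by blast
      show ?thesis
      proof (cases "i \<in> A")
        case False
        then show ?thesis using strict_mono_on_onto_lessThan[OF _ less k] True
          by (simp add: A_def lp_def sg_def)
      next
        case iA: True
        then have "strict_antimono_on {1..n} (\<lambda>k. q k i)" using alt[OF i] True by (auto simp: A_def S_def)
        then show ?thesis using strict_antimono_on_onto_lessThan[OF _ less k] True iA
          by (simp add: lp_def sg_def)
      qed
    qed
  qed (use qC k in simp)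
  have "L = q ` {1..n}" using q by (simp add: bij_betw_def)
  also have "\<dots> = (\<lambda>k. lp (q 1) S A (k - 1)) ` {1..n}" using * by (rule image_cong[OF refl])
  also have "\<dots> = lp (q 1) S A ` (\<lambda>k. k - 1) ` {1..n}" by (simp add: image_image)
  also have "(\<lambda>k. k - 1) ` {1..n} = {..<n}"
  proof
    show "{..<n} \<subseteq> (\<lambda>k. k - 1) ` {1..n}"
      by (rule subsetI, rule_tac x = "Suc x" in image_eqI) auto
  qed auto
  finally have "L = lp (q 1) S A ` {..<n}" .
  moreover have "S \<noteq> {}" "S \<subseteq> I" using nc by (auto simp: S_def)
  moreover have "q 1 \<in> C" using qC n3 by simp
  ultimately show "\<exists>x S A. x \<in> C \<and> S \<subseteq> I \<and> S \<noteq> {} \<and> L = lp x S A ` {..<n}" by blast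
next
  assume "\<exists>x S A. x \<in> C \<and> S \<subseteq> I \<and> S \<noteq> {} \<and> L = lp x S A ` {..<n}"
  then obtain x S A where x: "x \<in> C" "S \<subseteq> I" "S \<noteq> {}" and L: "L = lp x S A ` {..<n}" by blast
  obtain i where i: "i \<in> S" using x(3) by blast
  have inj: "inj_on (lp x S A) {..<n}"
  proof (rule inj_onI)
    fix s t assume "s \<in> {..<n}" "t \<in> {..<n}" "lp x S A s = lp x S A t"
    then show "s = t" using i by (metis lessThan_iff lp_def sg_inj)
  qed
  have p: "bij_betw (\<lambda>k. k - 1) {1..n} {..<n}"
    by (rule bij_betw_byWitness[where f' = Suc]) auto
  have "bij_betw (lp x S A \<circ> (\<lambda>k. k - 1)) {1..n} L"
    by (rule bij_betw_trans[OF p]) (simp add: L inj bij_betw_def)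
  moreover have "strict_mono_on {1..n} (\<lambda>k. (lp x S A \<circ> (\<lambda>k. k - 1)) k j) \<or>
                    strict_antimono_on {1..n} (\<lambda>k. (lp x S A \<circ> (\<lambda>k. k - 1)) k j) \<or>
                    (\<exists>c. \<forall>k\<in>{1..n}. (lp x S A \<circ> (\<lambda>k. k - 1)) k j = c)" for j
  proof (cases "j \<in> S")
    case True
    show ?thesis
    proof (cases "j \<in> A")
      case jA: True
      have "strict_antimono_on {1..n} (\<lambda>k. (lp x S A \<circ> (\<lambda>k. k - 1)) k j)"
      proof (rule monotone_onI)
        fix r s assume "r \<in> {1..n}" "s \<in> {1..n}" "r < s"
        then show "(lp x S A \<circ> (\<lambda>k. k - 1)) s j < (lp x S A \<circ> (\<lambda>k. k - 1)) r j"
          using True jA by (simp add: lp_def sg_def rv_def)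
      qed
      then show ?thesis by blast
    next
      case jA: False
      have "strict_mono_on {1..n} (\<lambda>k. (lp x S A \<circ> (\<lambda>k. k - 1)) k j)"
        by (rule strict_mono_onI) (use True jA in \<open>simp add: lp_def sg_def\<close>)
      then show ?thesis by blast
    qed
  qed (auto simp: lp_def)
  moreover have "\<not> (\<exists>c. \<forall>k\<in>{1..n}. (lp x S A \<circ> (\<lambda>k. k - 1)) k i = c)"
  proof
    assume "\<exists>c. \<forall>k\<in>{1..n}. (lp x S A \<circ> (\<lambda>k. k - 1)) k i = c"
    then obtain c where c: "\<And>k. k \<in> {1..n} \<Longrightarrow> sg A i (k - 1) = c" using i by (auto simp: lp_def)
    show False using c[of 1] c[of 2] n3 sg_inj[of 0 1 A i] by (simp add: One_nat_def)
  qed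
  moreover have "L \<subseteq> C" using x L lp_in_C by auto
  ultimately show "line L" unfolding is_line_def using i x(2) by blast
qed

lemma line_subset: "line L \<Longrightarrow> L \<subseteq> C"
  by (simp add: is_line_def)

text \<open>Collinearity expressed in coordinates only: any two coordinates in which the points
  differ must move in parallel or as mirror images. Equal points count as collinear.\<close>

definition coll :: "(nat \<Rightarrow> nat) \<Rightarrow> (nat \<Rightarrow> nat) \<Rightarrow> bool" where
  "coll X Y \<longleftrightarrow> (\<forall>i\<in>I. \<forall>j\<in>I. X i \<noteq> Y i \<longrightarrow> X j \<noteq> Y j \<longrightarrow>
     X i = X j \<and> Y i = Y j \<or> X i = rv (X j) \<and> Y i = rv (Y j))"

text \<open>For distinct collinear points this is the line through them, described by the two points
  without reference to a parametrization.\<close>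

definition span :: "(nat \<Rightarrow> nat) \<Rightarrow> (nat \<Rightarrow> nat) \<Rightarrow> (nat \<Rightarrow> nat) set" where
  "span X Y = {Z \<in> C. (\<forall>i\<in>I. X i = Y i \<longrightarrow> Z i = X i) \<and>
     (\<forall>i\<in>I. \<forall>j\<in>I. X i \<noteq> Y i \<longrightarrow> X j \<noteq> Y j \<longrightarrow>
        (X i = X j \<and> Y i = Y j \<longrightarrow> Z i = Z j) \<and>
        (X i = rv (X j) \<and> Y i = rv (Y j) \<longrightarrow> Z i = rv (Z j)))}"

text \<open>At most one of \<open>s\<close> and \<open>t\<close> is the middle value. Hence two
  points determine both the active set \<open>S\<close> and, for any two active coordinates, whether
  they run in the same or in opposite directions.\<close>

lemma span_lp:
  assumes x: "x \<in> C" "S \<subseteq> I" and st: "s < n" "t < n" "s \<noteq> t"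
  shows "span (lp x S A s) (lp x S A t) = lp x S A ` {..<n}"
proof -
  let ?X = "lp x S A s" and ?Y = "lp x S A t"
  have diff: "?X i \<noteq> ?Y i \<longleftrightarrow> i \<in> S" for i
    using st by (simp add: lp_def sg_inj)
  show ?thesis
  proof
    show "lp x S A ` {..<n} \<subseteq> span ?X ?Y"
    proof
      fix Z assume "Z \<in> lp x S A ` {..<n}"
      then obtain r where r: "r < n" "Z = lp x S A r" by auto
      have "Z i = ?X i" if "i \<notin> S" for i using that r by (simp add: lp_def)
      moreover have "(?X i = ?X j \<and> ?Y i = ?Y j \<longrightarrow> Z i = Z j) \<and>
        (?X i = rv (?X j) \<and> ?Y i = rv (?Y j) \<longrightarrow> Z i = rv (Z j))" if "i \<in> S" "j \<in> S" for i j
        using that st r by (auto simp: lp_def sg_def rv_def split: if_splits)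
      moreover have "Z \<in> C" using lp_in_C[OF x r(1)] r(2) by simp
      ultimately show "Z \<in> span ?X ?Y"
        unfolding span_def diff using diff by blast
    qed
    show "span ?X ?Y \<subseteq> lp x S A ` {..<n}"
    proof
      fix Z assume Z: "Z \<in> span ?X ?Y"
      then have ZC: "Z \<in> C" by (simp add: span_def)
      show "Z \<in> lp x S A ` {..<n}"
      proof (cases "S = {}")
        case True
        have "Z = lp x S A 0"
        proof (rule C_ext[OF ZC lp_in_C[OF x]])
          show "Z i = lp x S A 0 i" if "i \<in> I" for i
            using Z that diff[of i] True by (auto simp: span_def lp_def)
        qed (use n3 in simp)
        then show ?thesis using n3 by auto
      next
        case False
        then obtain i where i: "i \<in> S" by blast
        \<comment> \<open>Any active coordinate reveals the parameter of \<open>Z\<close>, because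
          \<open>sg A i\<close> is its own inverse.\<close>
        define r where "r = sg A i (Z i)"
        have r: "r < n" using ZC i x(2) C_less by (auto simp: r_def)
        have Zi: "Z i = sg A i r" unfolding r_def using ZC i x(2) C_less by (metis sg_sg subsetD)
        have "Z = lp x S A r"
        proof (rule C_ext[OF ZC lp_in_C[OF x r]])
          fix j assume j: "j \<in> I"
          show "Z j = lp x S A r j"
          proof (cases "j \<in> S")
            case False
            then show ?thesis using Z j diff[of j] by (auto simp: span_def lp_def)
          next
            case jS: True
            have c: "(?X j = ?X i \<and> ?Y j = ?Y i \<longrightarrow> Z j = Z i)"
              "(?X j = rv (?X i) \<and> ?Y j = rv (?Y i) \<longrightarrow> Z j = rv (Z i))"
              using Z diff[of i] diff[of j] i jS x(2) unfolding span_def by blast+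
            show ?thesis
            proof (cases "(i \<in> A) = (j \<in> A)")
              case True
              then have "Z j = Z i" using c(1) i jS by (simp add: lp_def sg_def)
              then show ?thesis using Zi True jS by (simp add: lp_def sg_def)
            next
              case False
              then have "Z j = rv (Z i)" using c(2) i jS st by (auto simp: lp_def sg_def)
              then show ?thesis using Zi False jS r by (auto simp: lp_def sg_def)
            qed
          qed
        qed
        then show ?thesis using r by auto
      qed
    qed
  qed
qed

lemma line_eq_span:
  assumes "line L" "X \<in> L" "Y \<in> L" "X \<noteq> Y"
  shows "L = span X Y"
proof -
  obtain x S A where x: "x \<in> C" "S \<subseteq> I" and L: "L = lp x S A ` {..<n}"
    using assms(1) unfolding line_iff by blast
  obtain s t where "s < n" "t < n" "X = lp x S A s" "Y = lp x S A t" using assms(2,3) L by blast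
  then show ?thesis using span_lp[OF x, of s t A] assms(4) L by metis
qed

lemma line_unique:
  "line L \<Longrightarrow> line M \<Longrightarrow> X \<in> L \<Longrightarrow> Y \<in> L \<Longrightarrow> X \<in> M \<Longrightarrow> Y \<in> M \<Longrightarrow> X \<noteq> Y \<Longrightarrow> L = M"
  using line_eq_span by metis

lemma line_imp_coll:
  assumes "line L" "X \<in> L" "Y \<in> L"
  shows "coll X Y"
proof -
  obtain x S A s t where x: "x \<in> C" "S \<subseteq> I" "S \<noteq> {}" and L: "L = lp x S A ` {..<n}"
    and st: "s < n" "t < n" "X = lp x S A s" "Y = lp x S A t"
    using assms unfolding line_iff by blast
  show ?thesis unfolding coll_def st using st(1,2) by (auto simp: lp_def sg_def)
qed

lemma span_self: "X \<in> C \<Longrightarrow> X \<in> span X Y"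
  by (auto simp: span_def)

lemma span_self': "Y \<in> C \<Longrightarrow> Y \<in> span X Y"
  by (auto simp: span_def)

lemma coll_imp_line:
  assumes X: "X \<in> C" "Y \<in> C" "X \<noteq> Y" and c: "coll X Y"
  shows "line (span X Y)"
proof -
  obtain i where i: "i \<in> I" "X i \<noteq> Y i" using C_neq X by blast
  define S where "S = {j \<in> I. X j \<noteq> Y j}"
  \<comment> \<open>Coordinate \<open>i\<close> is taken as the reference direction; active
    coordinates that do not copy it must mirror it.\<close>
  define A where "A = {j. \<not> (X j = X i \<and> Y j = Y i)}"
  have S: "S \<subseteq> I" "i \<in> S" using i by (auto simp: S_def)
  have less: "X i < n" "Y i < n" using C_less X i by auto
  have alt: "X j = X i \<and> Y j = Y i \<or> X j = rv (X i) \<and> Y j = rv (Y i)" if "j \<in> S" for j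
    using c that i by (auto simp: coll_def S_def)
  have "X = lp X S A (X i)"
    by (rule C_ext[OF X(1) lp_in_C[OF X(1) S(1) less(1)]]) (use alt in \<open>auto simp: lp_def sg_def A_def\<close>)
  moreover have "Y = lp X S A (Y i)"
    by (rule C_ext[OF X(2) lp_in_C[OF X(1) S(1) less(2)]])
       (use alt in \<open>auto simp: lp_def sg_def A_def S_def\<close>)
  ultimately have "span X Y = lp X S A ` {..<n}"
    using span_lp[OF X(1) S(1) less i(2)] by metis
  then show ?thesis using X S by (auto simp: line_iff)
qed

lemma collD:
  assumes "coll X Y" "i \<in> I" "j \<in> I" "X i \<noteq> Y i" "X j \<noteq> Y j"
  shows "X i = X j \<and> Y i = Y j \<or> X i = rv (X j) \<and> Y i = rv (Y j)"
  using assms unfolding coll_def by blast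

subsection \<open>Transversals through a point of a main diagonal\<close>

text \<open>\<open>pt A\<close> parametrizes the main diagonal with sign set \<open>A\<close>;
  complementary sets give the same diagonal in reverse. In particular \<open>pt {}\<close> runs
  along the points with equal coordinates, and the points \<open>pt A 0\<close> are the
  corners.\<close>

definition pt :: "nat set \<Rightarrow> nat \<Rightarrow> nat \<Rightarrow> nat" where
  "pt A t = (\<lambda>i\<in>I. sg A i t)"

lemma pt_in_C [simp]: "t < n \<Longrightarrow> pt A t \<in> C"
  unfolding pt_def by (rule restrict_in_C) simp

lemma pt_apply: "i \<in> I \<Longrightarrow> pt A t i = sg A i t"
  by (simp add: pt_def)

lemma one_in_I: "1 \<in> I" and two_in_I: "2 \<in> I"
  using d2 by auto

lemma pt_compl: "t < n \<Longrightarrow> pt (I - A) t = pt A (rv t)"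
  by (auto simp: pt_def sg_def fun_eq_iff)

text \<open>At the middle level all sign sets give the centre. Away from it, complementing the set
  while reversing the parameter is the only ambiguity, as a comparison coordinate by coordinate
  shows.\<close>

lemma pt_eq_iff:
  assumes "A \<subseteq> I" "B \<subseteq> I" "s < n" "t < n" "t \<noteq> rv t"
  shows "pt A s = pt B t \<longleftrightarrow> A = B \<and> s = t \<or> A = I - B \<and> s = rv t"
proof
  assume eq: "pt A s = pt B t"
  have e: "sg A i s = sg B i t" if "i \<in> I" for i
    using fun_cong[OF eq, of i] that by (simp add: pt_apply)
  have "s = t \<or> s = rv t" using e[OF one_in_I] assms by (auto simp: sg_def rv_inj split: if_splits)
  then show "A = B \<and> s = t \<or> A = I - B \<and> s = rv t"
  proof
    assume s: "s = t"
    have "(i \<in> A) = (i \<in> B)" if "i \<in> I" for i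
      using e[OF that] s assms(5) by (auto simp: sg_def split: if_splits)
    then show ?thesis using s assms by blast
  next
    assume s: "s = rv t"
    have "(i \<in> A) = (i \<notin> B)" if "i \<in> I" for i
      using e[OF that] s assms(4,5) by (auto simp: sg_def split: if_splits)
    then show ?thesis using s assms by blast
  qed
next
  assume "A = B \<and> s = t \<or> A = I - B \<and> s = rv t"
  then show "pt A s = pt B t" using assms pt_compl[of "rv t" B] by auto
qed

definition noncentral_diag :: "(nat \<Rightarrow> nat) set" where
  "noncentral_diag = {pt A a | A a. A \<subseteq> I \<and> a < n \<and> a \<noteq> rv a}"

definition diag :: "(nat \<Rightarrow> nat) set" where
  "diag = {pt A a | A a. A \<subseteq> I \<and> a < n}"

lemma diag_iff: "P \<in> diag \<longleftrightarrow> P \<in> C \<and> (\<forall>i\<in>I. \<forall>j\<in>I. P i = P j \<or> P i = rv (P j))"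
proof
  assume "P \<in> diag"
  then show "P \<in> C \<and> (\<forall>i\<in>I. \<forall>j\<in>I. P i = P j \<or> P i = rv (P j))"
    by (auto simp: diag_def pt_apply sg_def)
next
  assume P: "P \<in> C \<and> (\<forall>i\<in>I. \<forall>j\<in>I. P i = P j \<or> P i = rv (P j))"
  have l: "P 1 < n" using P C_less one_in_I by blast
  have "P = pt {i \<in> I. P i \<noteq> P 1} (P 1)"
  proof (rule C_ext)
    fix i assume "i \<in> I"
    moreover have "P i = P 1 \<or> P i = rv (P 1)" using P one_in_I \<open>i \<in> I\<close> by blast
    ultimately show "P i = pt {i \<in> I. P i \<noteq> P 1} (P 1) i" by (auto simp: pt_apply sg_def)
  qed (use P l in auto)
  then show "P \<in> diag" unfolding diag_def using l by blast
qed

lemma noncentral_diag_iff: "P \<in> noncentral_diag \<longleftrightarrow> P \<in> diag \<and> P 1 \<noteq> rv (P 1)"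
proof -
  have "sg A i a \<noteq> rv (sg A i a) \<longleftrightarrow> a \<noteq> rv a" if "a < n" for A i a
    using that by (auto simp: sg_def)
  then show ?thesis unfolding noncentral_diag_def diag_def using pt_apply[OF one_in_I] by (auto; metis)
qed

lemma line_lp:
  assumes "S \<subseteq> I" "S \<noteq> {}" "x \<in> C"
  shows "line (lp x S A ` {..<n})"
  using assms by (auto simp: line_iff)

lemma lp_self:
  assumes "S \<subseteq> I" "\<And>i. i \<in> S \<Longrightarrow> x i = sg A i t"
  shows "lp x S A t = x"
  using assms by (auto simp: lp_def)

lemma lp_inj:
  assumes "i \<in> S" "s < n" "t < n" 
  shows "lp x S A s = lp x S A t \<longleftrightarrow> s = t"
proof
  assume "lp x S A s = lp x S A t"
  then show "s = t" using fun_cong[of _ _ i] assms by (metis (full_types) lp_def sg_inj)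
qed simp

lemma lp_pt_self: "S \<subseteq> I \<Longrightarrow> lp (pt A a) S A a = pt A a"
  by (rule lp_self) (auto simp: pt_apply)

text \<open>After undoing the signs \<open>A\<close>, all coordinates of the point equal
  \<open>a\<close>, and since \<open>a\<close> is not the middle value the active coordinates have
  to move in parallel. So the lines through the point correspond to nonempty sets of coordinates,
  and counting transversals becomes a matter of comparing two subsets.\<close>

lemma line_through_pt:
  assumes L: "line L" "pt A a \<in> L" and a: "a < n" "a \<noteq> rv a"
  obtains S where "S \<subseteq> I" "S \<noteq> {}" "L = lp (pt A a) S A ` {..<n}"
proof -
  let ?P = "pt A a"
  have PC: "?P \<in> C" using a by simp
  obtain x S0 A0 where x: "x \<in> C" "S0 \<subseteq> I" "S0 \<noteq> {}" and Ls: "L = lp x S0 A0 ` {..<n}"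
    using L by (auto simp: line_iff)
  obtain i0 where "i0 \<in> S0" using x by auto
  then have "lp x S0 A0 0 \<noteq> lp x S0 A0 1" using lp_inj n3 by simp
  then obtain Y where Y: "Y \<in> L" "Y \<noteq> ?P" unfolding Ls using n3
    by (metis imageI lessThan_iff less_le_trans one_less_numeral_iff semiring_norm(77) zero_less_numeral less_trans)
  have YC: "Y \<in> C" using Y L line_subset by blast
  obtain i where i: "i \<in> I" "?P i \<noteq> Y i" using C_neq PC YC Y by metis
  define S where "S = {j \<in> I. ?P j \<noteq> Y j}"
  define v where "v = sg A i (Y i)"
  have Yi: "Y i = sg A i v" "v < n" using C_less[OF YC i(1)] by (auto simp: v_def)
  have c: "coll ?P Y" using line_imp_coll L Y by blast
  have S: "S \<subseteq> I" "i \<in> S" using i by (auto simp: S_def)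
  have "Y = lp ?P S A v"
  proof (rule C_ext[OF YC lp_in_C[OF PC S(1) Yi(2)]])
    fix j assume j: "j \<in> I"
    show "Y j = lp ?P S A v j"
    proof (cases "j \<in> S")
      case True
      then have "?P j = ?P i \<and> Y j = Y i \<or> ?P j = rv (?P i) \<and> Y j = rv (Y i)"
        using c i by (auto simp: coll_def S_def)
      then show ?thesis using True Yi a i(1) j
        by (auto simp: lp_def pt_apply sg_def split: if_splits)
    qed (use j in \<open>auto simp: S_def lp_def\<close>)
  qed
  moreover have "?P = lp ?P S A a" using lp_pt_self S by simp
  moreover have "a \<noteq> v" using i Yi by (auto simp: pt_apply)
  ultimately have "span ?P Y = lp ?P S A ` {..<n}" using span_lp[OF PC S(1) a(1) Yi(2)] by metis
  then show thesis using that[of S] S line_eq_span[OF L(1,2) Y(1)] Y(2) by auto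
qed

definition transversals :: "(nat \<Rightarrow> nat) \<Rightarrow> (nat \<Rightarrow> nat) set \<Rightarrow> (nat \<Rightarrow> nat) set \<Rightarrow> ((nat \<Rightarrow> nat) \<times> (nat \<Rightarrow> nat)) set" where
  "transversals P L M = {(X, Y). X \<in> L \<and> Y \<in> M \<and> X \<noteq> P \<and> Y \<noteq> P \<and> X \<noteq> Y \<and> coll X Y}"

lemma lp_pt_apply: "i \<in> I \<Longrightarrow> lp (pt A a) S A t i = sg A i (if i \<in> S then t else a)"
  by (simp add: lp_def pt_apply)

text \<open>The points differ only where exactly one of the two sets is active. For nested sets this
  happens on one side only, with the same pair of values up to sign; if \<open>s = rv a\<close>, the
  pairs on the two sides are mirror images.\<close>

lemma coll_lp_same:
  assumes "a < n" "s < n" "S \<subseteq> I" "T \<subseteq> I" "s = rv a \<or> S \<subseteq> T \<or> T \<subseteq> S"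
  shows "coll (lp (pt A a) S A s) (lp (pt A a) T A s)"
  using assms unfolding coll_def by (auto simp: lp_pt_apply sg_def split: if_splits)

text \<open>Up to signs, a coordinate in \<open>S - T\<close> carries the values
  \<open>(s, a)\<close> and one in \<open>T - S\<close> the values \<open>(a, t)\<close>. These
  cannot agree, as \<open>s\<close> differs from \<open>a\<close>, so they are mirror
  images.\<close>

lemma coll_lp_incomparable:
  assumes "a < n" "a \<noteq> rv a" "s < n" "t < n" "S \<subseteq> I" "T \<subseteq> I" "s \<noteq> a" "t \<noteq> a" "\<not> S \<subseteq> T" "\<not> T \<subseteq> S"
    and "coll (lp (pt A a) S A s) (lp (pt A a) T A t)"
  shows "s = rv a \<and> t = rv a"
proof -
  obtain i j where ij: "i \<in> S" "i \<notin> T" "j \<in> T" "j \<notin> S" using assms by blast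
  then have I: "i \<in> I" "j \<in> I" using assms by auto
  let ?X = "lp (pt A a) S A s" and ?Y = "lp (pt A a) T A t"
  have "?X i = ?X j \<and> ?Y i = ?Y j \<or> ?X i = rv (?X j) \<and> ?Y i = rv (?Y j)"
    by (rule collD[OF assms(11) I]) (use ij I assms in \<open>auto simp: lp_pt_apply sg_inj\<close>)
  then show ?thesis using ij I assms(1-4,7,8)
    by (auto simp: lp_pt_apply sg_def rv_inj split: if_splits)
qed

definition never_0_2_transversals :: "(nat \<Rightarrow> nat) \<Rightarrow> bool" where
  "never_0_2_transversals P \<longleftrightarrow> P \<in> C \<and> (\<forall>L M. line L \<longrightarrow> line M \<longrightarrow> P \<in> L \<longrightarrow> P \<in> M \<longrightarrow> L \<noteq> M \<longrightarrow>
     card (transversals P L M) \<noteq> 0 \<and> card (transversals P L M) \<noteq> 2)"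

lemma finite_transversals: "line L \<Longrightarrow> line M \<Longrightarrow> finite (transversals P L M)"
proof -
  assume "line L" "line M"
  then have "transversals P L M \<subseteq> C \<times> C" using line_subset by (auto simp: transversals_def)
  then show ?thesis by (rule finite_subset) (simp add: finite_cube)
qed

text \<open>Points with the same parameter other than \<open>a\<close> are collinear, which gives
  \<open>n - 1\<close> transversals. Transversals are ordered pairs, so both orders of the two lines
  are treated side by side.\<close>

lemma card_transversals_comparable:
  fixes A :: "nat set"
  assumes a: "a < n" "a \<noteq> rv a" and S: "S \<subseteq> T" "S \<noteq> T" "T \<subseteq> I" "S \<noteq> {}"
  defines "P \<equiv> pt A a"
  shows "3 \<le> card (transversals P (lp P S A ` {..<n}) (lp P T A ` {..<n}))" (is "_ \<le> card ?T")
    and "3 \<le> card (transversals P (lp P T A ` {..<n}) (lp P S A ` {..<n}))" (is "_ \<le> card ?T'")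
proof -
  have PC: "P \<in> C" using a by (simp add: P_def)
  obtain i j where ij: "i \<in> S" "i \<in> T" "j \<in> T" "j \<notin> S" "i \<in> I" "j \<in> I" using S by blast
  define X Y where "X = lp P S A" and "Y = lp P T A"
  have XY: "X s i = sg A i s" "X s j = sg A j a" "Y s i = sg A i s" "Y s j = sg A j s" for s
    using ij by (auto simp: X_def Y_def P_def lp_pt_apply)
  have Pij: "P i = sg A i a" "P j = sg A j a" using ij by (auto simp: P_def pt_apply)
  have neq: "X s \<noteq> P" "Y s \<noteq> P" "X t \<noteq> Y s" "Y s \<noteq> X t" if "s < n" "s \<noteq> a" for s t
    using XY(1-4)[of s] XY(1-4)[of t] Pij a that sg_inj by metis+
  have inj: "X s \<noteq> X t" "Y s \<noteq> Y t" if "s < n" "t < n" "s \<noteq> t" for s t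
    using XY(1,3)[of s] XY(1,3)[of t] that sg_inj by metis+
  have fin: "finite ?T" "finite ?T'" using S PC by (auto intro!: finite_transversals line_lp)
  have same: "(X s, Y s) \<in> ?T \<and> (Y s, X s) \<in> ?T'" if s: "s < n" "s \<noteq> a" for s
  proof -
    have "coll (X s) (Y s)" "coll (Y s) (X s)" unfolding X_def Y_def P_def
      using S a s by (auto intro!: coll_lp_same)
    moreover have "X s \<in> lp P S A ` {..<n}" "Y s \<in> lp P T A ` {..<n}" using s by (auto simp: X_def Y_def)
    ultimately show ?thesis using neq[OF s] by (auto simp: transversals_def)
  qed
  show "3 \<le> card ?T" and "3 \<le> card ?T'"
  proof -
    have "3 \<le> card ?T \<and> 3 \<le> card ?T'"
    proof (cases "n = 3")
      case True \<comment> \<open>equal parameters give only two transversals here, but the middle value yields a third\<close>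
      have ra: "rv a < n" "rv a \<noteq> a" using a by auto
      have m: "1 < n" "1 \<noteq> a" "1 \<noteq> rv a" "rv 1 = 1" using a True unfolding rv_def by auto
      \<comment> \<open>Up to signs the values are \<open>(rv a, 1)\<close> on \<open>S\<close> and
        \<open>(a, 1)\<close> on \<open>T - S\<close>; these are mirror images because 1 is the
        middle value.\<close>
      have "coll (X (rv a)) (Y 1)" "coll (Y 1) (X (rv a))"
        unfolding X_def Y_def P_def coll_def using a S m
        by (auto simp: lp_pt_apply sg_def split: if_splits)
      moreover have "X (rv a) \<in> lp P S A ` {..<n}" "Y 1 \<in> lp P T A ` {..<n}"
        using ra m by (auto simp: X_def Y_def)
      ultimately have 3: "(X (rv a), Y 1) \<in> ?T \<and> (Y 1, X (rv a)) \<in> ?T'"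
        using neq[OF ra] neq[OF m(1,2)] by (auto simp: transversals_def)
      have "{(X 1, Y 1), (X (rv a), Y (rv a)), (X (rv a), Y 1)} \<subseteq> ?T"
        "{(Y 1, X 1), (Y (rv a), X (rv a)), (Y 1, X (rv a))} \<subseteq> ?T'"
        using 3 same[OF ra] same[OF m(1,2)] by auto
      then show ?thesis using inj[OF m(1) ra(1) m(3)]
        by (intro conjI three_subset_card[OF fin(1)] three_subset_card[OF fin(2)]) auto
    next
      case False
      then have "3 \<le> card ({..<n} - {a})" using a n3 by simp
      then obtain U where U: "U \<subseteq> {..<n} - {a}" "card U = 3" using obtain_subset_with_card_n by metis
      have "inj_on (\<lambda>s. (X s, Y s)) U" "inj_on (\<lambda>s. (Y s, X s)) U"
        by (rule inj_onI, use U inj in blast)+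
      then have "card ((\<lambda>s. (X s, Y s)) ` U) = 3" "card ((\<lambda>s. (Y s, X s)) ` U) = 3"
        using U by (auto simp: card_image)
      moreover have "(\<lambda>s. (X s, Y s)) ` U \<subseteq> ?T" "(\<lambda>s. (Y s, X s)) ` U \<subseteq> ?T'" using U same by auto
      ultimately show ?thesis using card_mono[OF fin(1)] card_mono[OF fin(2)] by metis
    qed
    then show "3 \<le> card ?T" "3 \<le> card ?T'" by auto
  qed
qed

text \<open>Collinearity forces both parameters to be \<open>rv a\<close>, and that pair is indeed
  collinear.\<close>

lemma card_transversals_incomparable:
  fixes A :: "nat set"
  assumes a: "a < n" "a \<noteq> rv a" and S: "S \<subseteq> I" "T \<subseteq> I" "\<not> S \<subseteq> T" "\<not> T \<subseteq> S"
  defines "P \<equiv> pt A a"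
  shows "card (transversals P (lp P S A ` {..<n}) (lp P T A ` {..<n})) = 1" (is "card ?T = _")
proof -
  obtain i j where ij: "i \<in> S" "i \<notin> T" "i \<in> I" "j \<in> T" "j \<in> I" using S by blast
  have "?T = {(lp P S A (rv a), lp P T A (rv a))}"
  proof (intro equalityI subsetI)
    fix Z assume Z: "Z \<in> ?T"
    then obtain s t where st: "s < n" "t < n" "Z = (lp P S A s, lp P T A t)" by (auto simp: transversals_def)
    have "s \<noteq> a" "t \<noteq> a" using Z S by (auto simp: transversals_def st P_def lp_pt_self)
    then have "s = rv a \<and> t = rv a"
      using coll_lp_incomparable[of a s t S T A] a st S Z by (auto simp: transversals_def P_def)
    then show "Z \<in> {(lp P S A (rv a), lp P T A (rv a))}" using st by simp
  next
    fix Z assume Z: "Z \<in> {(lp P S A (rv a), lp P T A (rv a))}"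
    have c: "coll (lp P S A (rv a)) (lp P T A (rv a))" unfolding P_def
      by (rule coll_lp_same) (use a S in auto)
    have "lp P S A (rv a) i = sg A i (rv a)" "lp P T A (rv a) i = sg A i a" "P i = sg A i a"
      "lp P T A (rv a) j = sg A j (rv a)" "P j = sg A j a"
      using ij by (auto simp: P_def lp_pt_apply pt_apply)
    then have "lp P S A (rv a) \<noteq> lp P T A (rv a)" "lp P S A (rv a) \<noteq> P" "lp P T A (rv a) \<noteq> P"
      using a sg_inj rv_less by metis+
    then show "Z \<in> ?T" using c Z by (auto simp: transversals_def)
  qed
  then show ?thesis by simp
qed

lemma diag_imp_never_0_2_transversals:
  assumes "P \<in> noncentral_diag"
  shows "never_0_2_transversals P"
proof -
  obtain A a where P: "P = pt A a" and a: "a < n" "a \<noteq> rv a" using assms by (auto simp: noncentral_diag_def)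
  show ?thesis unfolding never_0_2_transversals_def
  proof (intro conjI allI impI)
    fix L M assume LM: "line L" "line M" "P \<in> L" "P \<in> M" "L \<noteq> M"
    obtain S where S: "S \<subseteq> I" "S \<noteq> {}" "L = lp P S A ` {..<n}"
      using line_through_pt[OF LM(1) _ a] LM P by metis
    obtain T where T: "T \<subseteq> I" "T \<noteq> {}" "M = lp P T A ` {..<n}"
      using line_through_pt[OF LM(2) _ a] LM P by metis
    have "S \<noteq> T" using S T LM by auto
    then consider "S \<subseteq> T" | "T \<subseteq> S" | "\<not> S \<subseteq> T" "\<not> T \<subseteq> S" by blast
    then have "card (transversals P L M) = 1 \<or> 3 \<le> card (transversals P L M)"
      using card_transversals_comparable[OF a] card_transversals_incomparable[OF a] S T \<open>S \<noteq> T\<close> unfolding P by cases metis+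
    then show "card (transversals P L M) \<noteq> 0" "card (transversals P L M) \<noteq> 2" by auto
  qed (use P a in simp)
qed

text \<open>Two axis-parallel lines through \<open>P\<close> are enough to violate the condition: at
  the centre they have no transversal, and if \<open>P\<close> has two coordinates that are neither
  equal nor mirror images, the lines in these two directions have exactly two.\<close>

lemma never_0_2_transversals_imp_diag:
  assumes "never_0_2_transversals P"
  shows "P \<in> noncentral_diag"
proof (rule ccontr)
  assume nD: "P \<notin> noncentral_diag"
  have PC: "P \<in> C" using assms by (simp add: never_0_2_transversals_def)
  define ax where "ax i = lp P {i} {} ` {..<n}" for i
  have lp: "lp P {i} {} s = P(i := s)" for i s by (auto simp: lp_def sg_def)
  have ax: "X \<in> ax i \<longleftrightarrow> (\<exists>s<n. X = P(i := s))" for X i by (auto simp: ax_def lp)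
  have axl: "line (ax i)" "P \<in> ax i" if "i \<in> I" for i
  proof -
    show "line (ax i)" unfolding ax_def using that PC by (intro line_lp) auto
    show "P \<in> ax i" unfolding ax using C_less[OF PC that] by (metis fun_upd_triv)
  qed
  \<comment> \<open>The two points can differ only at \<open>i\<close> and \<open>j\<close>, where
    they carry \<open>(s, P i)\<close> and \<open>(P j, t)\<close>; collinearity is the single
    condition that these pairs agree or are mirror images.\<close>
  have tr_eq: "transversals P (ax i) (ax j) = {(P(i := s), P(j := t)) | s t. s < n \<and> t < n \<and> s \<noteq> P i \<and> t \<noteq> P j \<and>
      (s = P j \<and> P i = t \<or> s = rv (P j) \<and> P i = rv t)}" (is "_ = ?R") if ij: "i \<in> I" "j \<in> I" "i \<noteq> j" for i j
  proof -
    have c: "coll (P(i := s)) (P(j := t)) \<longleftrightarrow> s = P j \<and> P i = t \<or> s = rv (P j) \<and> P i = rv t"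
      if "s \<noteq> P i" "t \<noteq> P j" "s < n" "t < n" for s t
    proof
      assume "coll (P(i := s)) (P(j := t))"
      from collD[OF this ij(1,2)] show "s = P j \<and> P i = t \<or> s = rv (P j) \<and> P i = rv t"
        using that ij(3) by auto
    next
      assume *: "s = P j \<and> P i = t \<or> s = rv (P j) \<and> P i = rv t"
      have ij_only: "k = i \<or> k = j" if "(P(i := s)) k \<noteq> (P(j := t)) k" for k
        using that by (metis fun_upd_other)
      have l: "P j < n" using C_less PC ij by blast
      show "coll (P(i := s)) (P(j := t))" unfolding coll_def
      proof (intro ballI impI)
        fix k l assume "(P(i := s)) k \<noteq> (P(j := t)) k" "(P(i := s)) l \<noteq> (P(j := t)) l"
        then have "k = i \<or> k = j" "l = i \<or> l = j" using ij_only by auto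
        then show "(P(i := s)) k = (P(i := s)) l \<and> (P(j := t)) k = (P(j := t)) l \<or>
          (P(i := s)) k = rv ((P(i := s)) l) \<and> (P(j := t)) k = rv ((P(j := t)) l)"
          using * ij(3) l that by auto
      qed
    qed
    have ne: "P(i := s) \<noteq> P \<longleftrightarrow> s \<noteq> P i" for i s by (metis fun_upd_same fun_upd_triv)
    have ne2: "P(i := s) \<noteq> P(j := t)" if "s \<noteq> P i" for s t using ij that by (metis fun_upd_same fun_upd_other)
    show ?thesis
    proof (intro equalityI subsetI)
      fix Z assume "Z \<in> transversals P (ax i) (ax j)"
      then obtain s t where st: "s < n" "t < n" "Z = (P(i := s), P(j := t))"
        and "P(i := s) \<noteq> P" "P(j := t) \<noteq> P" "coll (P(i := s)) (P(j := t))"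
        unfolding transversals_def ax by blast
      moreover then have "s \<noteq> P i" "t \<noteq> P j" by (auto simp: ne)
      ultimately show "Z \<in> ?R" using c[of s t] by blast
    next
      fix Z assume "Z \<in> ?R"
      then obtain s t where Z: "Z = (P(i := s), P(j := t))" and st: "s < n" "t < n" "s \<noteq> P i" "t \<noteq> P j"
        and "s = P j \<and> P i = t \<or> s = rv (P j) \<and> P i = rv t" by blast
      then have "coll (P(i := s)) (P(j := t))" using c[of s t] by blast
      moreover have "P(i := s) \<in> ax i" "P(j := t) \<in> ax j" using ax st by blast+
      ultimately show "Z \<in> transversals P (ax i) (ax j)" unfolding transversals_def Z using ne[of i s] ne[of j t] ne2[of s t] st by simp
    qed
  qed
  have axne: "ax i \<noteq> ax j" if ij: "i \<in> I" "j \<in> I" "i \<noteq> j" for i j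
  proof
    assume e: "ax i = ax j"
    obtain s where s: "s < n" "s \<noteq> P i" using that[of 0] that[of 1] n3 by force
    then have "P(i := s) \<in> ax j" using e ax by blast
    then obtain t where "P(i := s) = P(j := t)" using ax by blast
    then show False using s ij by (metis fun_upd_same fun_upd_other)
  qed
  have axg: "card (transversals P (ax i) (ax j)) \<noteq> 0 \<and> card (transversals P (ax i) (ax j)) \<noteq> 2"
    if ij: "i \<in> I" "j \<in> I" "i \<noteq> j" for i j
    using assms axl[OF ij(1)] axl[OF ij(2)] axne[OF ij] unfolding never_0_2_transversals_def by simp
  show False
  proof (cases "P \<in> diag")
    case True
    then have m: "P 1 = rv (P 1)" using nD noncentral_diag_iff by blast
    then have "P 2 = P 1" using True two_in_I one_in_I unfolding diag_iff by metis
    \<comment> \<open>Both alternatives would make \<open>s\<close> the middle value, which is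
      already \<open>P 1\<close>.\<close>
    then have "transversals P (ax 1) (ax 2) = {}" using tr_eq[OF one_in_I two_in_I] m by auto
    then show False using axg[OF one_in_I two_in_I] by simp
  next
    case False
    then obtain i j where ij: "i \<in> I" "j \<in> I" "P i \<noteq> P j" "P i \<noteq> rv (P j)" using PC diag_iff by blast
    then have "i \<noteq> j" by auto
    have l: "P i < n" "P j < n" using C_less PC ij by auto
    have "transversals P (ax i) (ax j) = {(P(i := P j), P(j := P i)), (P(i := rv (P j)), P(j := rv (P i)))}"
      (is "_ = {?p, ?q}")
    proof
      show "transversals P (ax i) (ax j) \<subseteq> {?p, ?q}" unfolding tr_eq[OF ij(1,2) \<open>i \<noteq> j\<close>] by auto
      have "rv (P i) \<noteq> P j" "rv (P j) \<noteq> P i" using ij l by (metis rv_rv)+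
      then have "\<exists>s t. ?q = (P(i := s), P(j := t)) \<and> s < n \<and> t < n \<and> s \<noteq> P i \<and> t \<noteq> P j \<and>
          (s = P j \<and> P i = t \<or> s = rv (P j) \<and> P i = rv t)"
        using l by (intro exI[of _ "rv (P j)"] exI[of _ "rv (P i)"]) simp
      moreover have "\<exists>s t. ?p = (P(i := s), P(j := t)) \<and> s < n \<and> t < n \<and> s \<noteq> P i \<and> t \<noteq> P j \<and>
          (s = P j \<and> P i = t \<or> s = rv (P j) \<and> P i = rv t)"
        using l ij(3) by (intro exI[of _ "P j"] exI[of _ "P i"]) simp
      ultimately have "?q \<in> transversals P (ax i) (ax j)" "?p \<in> transversals P (ax i) (ax j)"
        unfolding tr_eq[OF ij(1,2) \<open>i \<noteq> j\<close>] mem_Collect_eq .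
      then show "{?p, ?q} \<subseteq> transversals P (ax i) (ax j)" by blast
    qed
    \<comment> \<open>If the two transversals coincided, \<open>P i\<close> and \<open>P j\<close>
      would both be the middle value, hence equal.\<close>
    moreover have "(P(i := P j), P(j := P i)) \<noteq> (P(i := rv (P j)), P(j := rv (P i)))"
    proof
      assume "(P(i := P j), P(j := P i)) = (P(i := rv (P j)), P(j := rv (P i)))"
      then have "P j = rv (P j)" "P i = rv (P i)" by (metis Pair_inject fun_upd_same)+
      then show False using ij l by (auto simp: rv_def)
    qed
    ultimately have "card (transversals P (ax i) (ax j)) = 2" by simp
    then show False using axg[OF ij(1,2) \<open>i \<noteq> j\<close>] by simp
  qed
qed

subsection \<open>Line-preserving bijections\<close>

text \<open>Preservation of lines in both directions is built in, so that quotients of such maps are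
  again of this kind; \<open>line_group_aut\<close> derives it from one direction. Values outside
  the cube are left free.\<close>

definition aut :: "((nat \<Rightarrow> nat) \<Rightarrow> nat \<Rightarrow> nat) \<Rightarrow> bool" where
  "aut f \<longleftrightarrow> bij_betw f C C \<and> (\<forall>L. L \<subseteq> C \<longrightarrow> line (f ` L) \<longleftrightarrow> line L)"

lemma aut_C: "aut f \<Longrightarrow> x \<in> C \<Longrightarrow> f x \<in> C"
  by (auto simp: aut_def bij_betw_def)

lemma aut_eq: "aut f \<Longrightarrow> x \<in> C \<Longrightarrow> y \<in> C \<Longrightarrow> f x = f y \<longleftrightarrow> x = y"
  by (auto simp: aut_def bij_betw_def inj_on_def)

lemma aut_surj: "aut f \<Longrightarrow> y \<in> C \<Longrightarrow> \<exists>x\<in>C. y = f x"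
  by (auto simp: aut_def bij_betw_def image_iff)

lemma aut_line: "aut f \<Longrightarrow> line L \<Longrightarrow> line (f ` L)"
  using line_subset by (auto simp: aut_def)

lemma aut_mem: "aut f \<Longrightarrow> L \<subseteq> C \<Longrightarrow> x \<in> C \<Longrightarrow> f x \<in> f ` L \<longleftrightarrow> x \<in> L"
  using aut_eq by blast

lemma coll_iff_line:
  assumes "X \<in> C" "Y \<in> C" "X \<noteq> Y"
  shows "coll X Y \<longleftrightarrow> (\<exists>L. line L \<and> X \<in> L \<and> Y \<in> L)"
  using assms line_imp_coll coll_imp_line span_self span_self' by metis

lemma coll_refl: "coll X X"
  by (simp add: coll_def)

lemma aut_line_preimage:
  assumes f: "aut f" and L: "line L"
  obtains M where "line M" "L = f ` M"
proof -
  have "L \<subseteq> f ` C" using f L line_subset by (simp add: aut_def bij_betw_def)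
  then obtain M where "M \<subseteq> C" "L = f ` M" by (metis subset_imageE)
  then show thesis using that f L by (metis aut_def)
qed

lemma aut_coll:
  assumes f: "aut f" and XY: "X \<in> C" "Y \<in> C"
  shows "coll (f X) (f Y) \<longleftrightarrow> coll X Y"
proof (cases "X = Y")
  case False
  have "(\<exists>L. line L \<and> f X \<in> L \<and> f Y \<in> L) \<longleftrightarrow> (\<exists>L. line L \<and> X \<in> L \<and> Y \<in> L)"
  proof
    assume "\<exists>L. line L \<and> f X \<in> L \<and> f Y \<in> L"
    then obtain L where L: "line L" "f X \<in> L" "f Y \<in> L" by blast
    obtain M where M: "line M" "L = f ` M" using aut_line_preimage[OF f L(1)] by blast
    then show "\<exists>L. line L \<and> X \<in> L \<and> Y \<in> L" using L aut_mem[OF f line_subset] XY by blast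
  qed (use f aut_line in blast)
  then show ?thesis using coll_iff_line XY False aut_C[OF f] aut_eq[OF f] by simp
qed (simp add: coll_refl)

lemma aut_span:
  assumes f: "aut f" and XY: "X \<in> C" "Y \<in> C" "X \<noteq> Y" "coll X Y"
  shows "f ` span X Y = span (f X) (f Y)"
  by (rule line_eq_span) (use assms aut_line coll_imp_line span_self span_self' aut_eq in auto)

text \<open>The quotient of \<open>f\<close> by \<open>e\<close> allows \<open>f\<close> to be
  normalized step by step by known maps until only the identity remains.\<close>

lemma aut_factor:
  assumes "aut e" "aut f"
  obtains g where "aut g" "\<And>x. x \<in> C \<Longrightarrow> f x = e (g x)"
proof -
  let ?g = "inv_into C e \<circ> f"
  have b: "bij_betw e C C" "bij_betw f C C" using assms by (auto simp: aut_def)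
  have bg: "bij_betw ?g C C" using b by (metis bij_betw_inv_into bij_betw_trans)
  have eq: "e (?g x) = f x" if "x \<in> C" for x
    using that b by (metis bij_betw_apply bij_betw_inv_into_right comp_apply)
  have "aut ?g" unfolding aut_def
  proof (intro conjI allI impI bg)
    fix L assume L: "L \<subseteq> C"
    then have gC: "?g ` L \<subseteq> C" using bg by (auto simp: bij_betw_def)
    have "e ` ?g ` L = f ` L" unfolding image_image using eq L by (intro image_cong) auto
    then show "line (?g ` L) = line L" using assms L gC unfolding aut_def by metis
  qed
  then show thesis using that eq by metis
qed

text \<open>Applying \<open>f\<close> to both entries of a pair is a bijection between the
  transversals at \<open>P\<close> and those at \<open>f P\<close>, since collinearity and
  distinctness are preserved both ways, and every line through \<open>f P\<close> is the image of
  one through \<open>P\<close>.\<close>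

lemma aut_never_0_2_transversals:
  assumes f: "aut f" and P: "P \<in> C"
  shows "never_0_2_transversals (f P) \<longleftrightarrow> never_0_2_transversals P"
proof -
  have tr_eq: "transversals (f P) (f ` L) (f ` M) = map_prod f f ` transversals P L M" if L: "line L" "line M" for L M
  proof (intro equalityI subsetI)
    fix Z assume "Z \<in> transversals (f P) (f ` L) (f ` M)"
    then obtain X Y where Z: "Z = (f X, f Y)" "X \<in> L" "Y \<in> M" "f X \<noteq> f P" "f Y \<noteq> f P" "f X \<noteq> f Y" "coll (f X) (f Y)"
      by (auto simp: transversals_def)
    moreover have "X \<in> C" "Y \<in> C" using Z L line_subset by blast+
    ultimately have "(X, Y) \<in> transversals P L M" using aut_coll[OF f] by (auto simp: transversals_def)
    then show "Z \<in> map_prod f f ` transversals P L M" using Z by force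
  next
    fix Z assume "Z \<in> map_prod f f ` transversals P L M"
    then obtain X Y where Z: "Z = (f X, f Y)" "X \<in> L" "Y \<in> M" "X \<noteq> P" "Y \<noteq> P" "X \<noteq> Y" "coll X Y"
      by (auto simp: transversals_def)
    moreover have "X \<in> C" "Y \<in> C" using Z L line_subset by blast+
    ultimately show "Z \<in> transversals (f P) (f ` L) (f ` M)" using aut_coll[OF f] aut_eq[OF f] P by (auto simp: transversals_def)
  qed
  have card: "card (transversals (f P) (f ` L) (f ` M)) = card (transversals P L M)" if L: "line L" "line M" for L M
    unfolding tr_eq[OF L]
  proof (rule card_image)
    have "transversals P L M \<subseteq> C \<times> C" using L line_subset by (auto simp: transversals_def)
    moreover have "inj_on (map_prod f f) (C \<times> C)" using f by (auto simp: aut_def bij_betw_def intro: map_prod_inj_on)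
    ultimately show "inj_on (map_prod f f) (transversals P L M)" by (rule inj_on_subset[rotated])
  qed
  have im: "f P \<in> f ` L \<longleftrightarrow> P \<in> L" "f ` L = f ` M \<longleftrightarrow> L = M" if "line L" "line M" for L M
    using that line_subset f P by (auto simp: aut_mem aut_def bij_betw_def inj_on_image_eq_iff)
  show ?thesis
  proof
    assume g: "never_0_2_transversals P"
    show "never_0_2_transversals (f P)" unfolding never_0_2_transversals_def
    proof (intro conjI allI impI)
      fix L' M' assume LM: "line L'" "line M'" "f P \<in> L'" "f P \<in> M'" "L' \<noteq> M'"
      obtain L where L: "line L" "L' = f ` L" using aut_line_preimage[OF f LM(1)] by blast
      obtain M where M: "line M" "M' = f ` M" using aut_line_preimage[OF f LM(2)] by blast
      have "card (transversals P L M) \<noteq> 0 \<and> card (transversals P L M) \<noteq> 2"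
        using g L M LM im[OF L(1) M(1)] im[OF M(1) L(1)] unfolding never_0_2_transversals_def by blast
      then show "card (transversals (f P) L' M') \<noteq> 0" "card (transversals (f P) L' M') \<noteq> 2" using card L M by auto
    qed (use aut_C f P in blast)
  next
    assume g: "never_0_2_transversals (f P)"
    show "never_0_2_transversals P" unfolding never_0_2_transversals_def
    proof (intro conjI allI impI)
      fix L M assume LM: "line L" "line M" "P \<in> L" "P \<in> M" "L \<noteq> M"
      have "card (transversals (f P) (f ` L) (f ` M)) \<noteq> 0 \<and> card (transversals (f P) (f ` L) (f ` M)) \<noteq> 2"
        using g LM im[OF LM(1,2)] aut_line[OF f] unfolding never_0_2_transversals_def by blast
      then show "card (transversals P L M) \<noteq> 0" "card (transversals P L M) \<noteq> 2" using card LM by auto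
    qed (use P in blast)
  qed
qed

section \<open>Invariance of the main diagonals\<close>

lemma noncentral_diag_in_C: "P \<in> noncentral_diag \<Longrightarrow> P \<in> C"
  by (auto simp: noncentral_diag_def)

lemma aut_noncentral_diag: "aut f \<Longrightarrow> P \<in> C \<Longrightarrow> f P \<in> noncentral_diag \<longleftrightarrow> P \<in> noncentral_diag"
  using aut_never_0_2_transversals diag_imp_never_0_2_transversals never_0_2_transversals_imp_diag by blast

text \<open>Transversal counts miss the centre, which exists for odd \<open>n\<close>. It is
  recovered as collinear with all noncentral points of main diagonals.\<close>

lemma diag_iff_coll: 
  assumes P: "P \<in> C"
  shows "P \<in> diag \<longleftrightarrow> P \<in> noncentral_diag \<or> (\<forall>Q\<in>noncentral_diag. coll P Q)"
proof
  assume D: "P \<in> diag"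
  show "P \<in> noncentral_diag \<or> (\<forall>Q\<in>noncentral_diag. coll P Q)"
  proof (cases "P \<in> noncentral_diag")
    case False
    then have m: "P 1 = rv (P 1)" using D noncentral_diag_iff by blast
    have c: "P i = P 1" if "i \<in> I" for i
      using D m that one_in_I unfolding diag_iff by metis
    have "coll P Q" if "Q \<in> noncentral_diag" for Q
    proof -
      have "\<forall>i\<in>I. \<forall>j\<in>I. Q i = Q j \<or> Q i = rv (Q j)" using that noncentral_diag_iff diag_iff by blast
      then show ?thesis unfolding coll_def using c m by (metis (no_types, lifting))
    qed
    then show ?thesis by blast
  qed simp
next
  assume D: "P \<in> noncentral_diag \<or> (\<forall>Q\<in>noncentral_diag. coll P Q)"
  show "P \<in> diag"
  proof (rule ccontr)
    assume nD: "P \<notin> diag"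
    then obtain i j where ij: "i \<in> I" "j \<in> I" "P i \<noteq> P j" "P i \<noteq> rv (P j)" using P diag_iff by blast
    \<comment> \<open>This corner differs from \<open>P\<close> in every coordinate: it has
      \<open>rv 0\<close> where \<open>P\<close> has 0, and 0 elsewhere. Collinearity with it
      therefore relates all coordinates of \<open>P\<close> to each other.\<close>
    define A where "A = {k \<in> I. P k = 0}"
    have r: "0 \<noteq> rv 0" "0 < n" using n3 by (auto simp: rv_def)
    then have "pt A 0 \<in> noncentral_diag" unfolding noncentral_diag_def A_def by blast
    then have "coll P (pt A 0)" using D nD noncentral_diag_iff by blast
    moreover have "P k \<noteq> pt A 0 k" if "k \<in> I" for k using r that by (auto simp: pt_apply sg_def A_def)
    ultimately show False using collD[of P _ i j] ij by blast
  qed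
qed

lemma aut_diag:
  assumes f: "aut f" and P: "P \<in> diag"
  shows "f P \<in> diag"
proof -
  have PC: "P \<in> C" using P diag_iff by blast
  have "f P \<in> noncentral_diag \<or> (\<forall>Q\<in>noncentral_diag. coll (f P) Q)"
  proof (cases "P \<in> noncentral_diag")
    case False
    have "coll (f P) Q" if Q: "Q \<in> noncentral_diag" for Q
    proof -
      obtain R where R: "R \<in> C" "Q = f R" using aut_surj[OF f noncentral_diag_in_C[OF Q]] by blast
      then have "R \<in> noncentral_diag" using Q aut_noncentral_diag f by blast
      then have "coll P R" using P diag_iff_coll[OF PC] False by blast
      then show ?thesis using R aut_coll f PC by blast
    qed
    then show ?thesis by blast
  qed (use aut_noncentral_diag f PC in blast)
  then show ?thesis using diag_iff_coll aut_C[OF f PC] by blast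
qed

lemma lp_full:
  assumes "x \<in> C" "t < n"
  shows "lp x I A t = pt A t"
  by (rule C_ext[OF lp_in_C[OF assms(1) subset_refl assms(2)] pt_in_C[OF assms(2)]])
     (auto simp: lp_def pt_apply)

lemma line_subset_diag:
  assumes L: "line L" "L \<subseteq> diag"
  obtains A where "A \<subseteq> I" "L = pt A ` {..<n}"
proof -
  obtain x S A where x: "x \<in> C" "S \<subseteq> I" "S \<noteq> {}" and Ls: "L = lp x S A ` {..<n}"
    using L unfolding line_iff by blast
  have "S = I"
  proof (rule ccontr)
    assume "S \<noteq> I"
    then obtain i j where ij: "i \<in> I" "i \<notin> S" "j \<in> S" "j \<in> I" using x by blast
    have "x i = sg A j t \<or> x i = rv (sg A j t)" if "t < n" for t
    proof -
      have "lp x S A t \<in> diag" using L(2) that Ls by blast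
      then have "lp x S A t i = lp x S A t j \<or> lp x S A t i = rv (lp x S A t j)"
        using ij unfolding diag_iff by blast
      then show ?thesis using ij by (simp add: lp_def)
    qed
    \<comment> \<open>A constant coordinate would have to belong both to the pair of 0 and to the
      pair of 1, which are disjoint as \<open>n\<close> is at least 3.\<close>
    from this[of 0] this[of 1] show False using n3 by (auto simp: sg_def rv_def split: if_splits)
  qed
  have "lp x S A t = pt (A \<inter> I) t" if "t < n" for t
    unfolding \<open>S = I\<close> lp_full[OF x(1) that] by (auto simp: pt_def sg_def)
  then have "L = pt (A \<inter> I) ` {..<n}" unfolding Ls by (intro image_cong) auto
  then show thesis using that by blast
qed

lemma line_diagonal: "line (pt A ` {..<n})"
proof -
  have p0: "pt A 0 \<in> C" using n3 by simp
  have "lp (pt A 0) I A t = pt A t" if "t < n" for t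
    using lp_full p0 that by blast
  then have "pt A ` {..<n} = lp (pt A 0) I A ` {..<n}" by (intro image_cong) auto
  then show ?thesis using line_lp[of I "pt A 0" A] p0 one_in_I by auto
qed

lemma coll_pt_same_level:
  assumes "s < n" "t = s \<or> t = rv s"
  shows "coll (pt A s) (pt B t)"
  using assms unfolding coll_def by (auto simp: pt_apply sg_def)

text \<open>Different main diagonals have a coordinate where their signs agree and one where they
  disagree. If the levels differed too, the points would differ everywhere, and comparing these two
  coordinates would make \<open>s\<close> or \<open>t\<close> the middle value.\<close>

lemma coll_pt_imp_same_level:
  assumes AB: "A \<subseteq> I" "B \<subseteq> I" "A \<noteq> B" "A \<noteq> I - B"
    and st: "s < n" "t < n" "s \<noteq> rv s" "t \<noteq> rv t" and c: "coll (pt A s) (pt B t)"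
  shows "t = s \<or> t = rv s"
proof (rule ccontr)
  assume *: "\<not> (t = s \<or> t = rv s)"
  obtain i where i: "i \<in> I" "(i \<in> A) \<noteq> (i \<in> B)" using AB by blast
  obtain j where j: "j \<in> I" "(j \<in> A) = (j \<in> B)" using AB by blast
  have ne: "pt A s k \<noteq> pt B t k" if "k \<in> I" for k
    using * that st by (auto simp: pt_apply sg_def rv_inj)
  show False using collD[OF c i(1) j(1) ne[OF i(1)] ne[OF j(1)]] i j st
    by (auto simp: pt_apply sg_def split: if_splits)
qed

subsection \<open>Signed coordinate permutations\<close>

lemma rv_eq: "n - t - 1 = rv t"
  by (simp add: rv_def)

lemma sym_permsD:
  assumes "p \<in> sym_perms n"
  shows "p permutes {..<n}" "t < n \<Longrightarrow> p t < n" "t < n \<Longrightarrow> p (rv t) = rv (p t)"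
    "s < n \<Longrightarrow> t < n \<Longrightarrow> p s = p t \<longleftrightarrow> s = t"
proof -
  show p: "p permutes {..<n}" using assms by (simp add: sym_perms_def)
  then show "p t < n" if "t < n" using that permutes_in_image[OF p, of t] by simp
  show "p (rv t) = rv (p t)" if "t < n" using assms that unfolding sym_perms_def rv_eq by blast
  show "p s = p t \<longleftrightarrow> s = t" using permutes_inj[OF p] by (auto dest: injD)
qed

lemma sym_permsI:
  assumes "p permutes {..<n}" "\<And>t. t < n \<Longrightarrow> p (rv t) = rv (p t)"
  shows "p \<in> sym_perms n"
  using assms unfolding sym_perms_def rv_eq by blast

lemma id_sym_perms: "id \<in> sym_perms n"
  by (simp add: sym_perms_def permutes_id)

lemma sym_perms_sg: "p \<in> sym_perms n \<Longrightarrow> t < n \<Longrightarrow> p (sg A i t) = sg A i (p t)"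
  using sym_permsD(3) by (simp add: sg_def)

text \<open>Coordinate \<open>i\<close> of the image is read from coordinate \<open>s i\<close>, so
  composition multiplies the permutations in reverse order. For \<open>p = id\<close> these are the
  signed permutations of coordinates; for \<open>s = id\<close> and \<open>B = {}\<close> they are
  the maps F_pi.\<close>

definition cube_map :: "(nat \<Rightarrow> nat) \<Rightarrow> nat set \<Rightarrow> (nat \<Rightarrow> nat) \<Rightarrow> (nat \<Rightarrow> nat) \<Rightarrow> nat \<Rightarrow> nat" where
  "cube_map s B p = (\<lambda>x\<in>C. \<lambda>i\<in>I. sg B i (p (x (s i))))"

lemma permutes_I: "s permutes I \<Longrightarrow> s i \<in> I \<longleftrightarrow> i \<in> I"
  by (rule permutes_in_image)

lemma cube_map_apply: "x \<in> C \<Longrightarrow> i \<in> I \<Longrightarrow> cube_map s B p x i = sg B i (p (x (s i)))"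
  by (simp add: cube_map_def)

lemma cube_map_in_C:
  assumes "s permutes I" "p \<in> sym_perms n" "x \<in> C"
  shows "cube_map s B p x \<in> C"
proof -
  have "x (s i) < n" if "i \<in> I" for i using C_less[OF assms(3)] permutes_I[OF assms(1)] that by blast
  then have "(\<lambda>i\<in>I. sg B i (p (x (s i)))) \<in> C"
    by (intro restrict_in_C) (simp add: sym_permsD(2)[OF assms(2)])
  then show ?thesis using assms(3) by (simp add: cube_map_def)
qed

lemma cube_map_pt:
  assumes "s permutes I" "p \<in> sym_perms n" "t < n"
  shows "cube_map s B p (pt A t) = pt {i \<in> I. (i \<in> B) \<noteq> (s i \<in> A)} (p t)"
proof (rule C_ext)
  fix i assume i: "i \<in> I"
  then have "pt A t (s i) = sg A (s i) t" using permutes_I[OF assms(1)] by (simp add: pt_apply)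
  then have "cube_map s B p (pt A t) i = sg B i (sg A (s i) (p t))"
    using i assms sym_perms_sg[OF assms(2,3)] by (simp add: cube_map_apply)
  then show "cube_map s B p (pt A t) i = pt {i \<in> I. (i \<in> B) \<noteq> (s i \<in> A)} (p t) i"
    using i sym_permsD(2)[OF assms(2,3)] by (auto simp: pt_apply sg_def)
qed (use assms cube_map_in_C sym_permsD in auto)

lemma cube_map_inj:
  assumes s: "s permutes I" and p: "p \<in> sym_perms n"
  shows "inj_on (cube_map s B p) C"
proof (rule inj_onI)
  fix x y assume xy: "x \<in> C" "y \<in> C" "cube_map s B p x = cube_map s B p y"
  show "x = y"
  proof (rule C_ext[OF xy(1,2)])
    fix j assume j: "j \<in> I"
    then obtain i where i: "i \<in> I" "j = s i" using permutes_image[OF s] by blast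
    have l: "x j < n" "y j < n" using C_less xy j by auto
    have "sg B i (p (x j)) = sg B i (p (y j))" using cube_map_apply i xy by metis
    then show "x j = y j" using l sym_permsD[OF p] by (simp add: sg_inj)
  qed
qed

lemma cube_map_Bij:
  assumes s: "s permutes I" and p: "p \<in> sym_perms n"
  shows "cube_map s B p \<in> Bij C"
proof -
  have "cube_map s B p ` C = C" by (rule endo_inj_surj[OF finite_cube _ cube_map_inj[OF s p]]) (use cube_map_in_C s p in auto)
  then show ?thesis using cube_map_inj[OF s p] by (simp add: Bij_def bij_betw_def cube_map_def)
qed

text \<open>As \<open>p\<close> commutes with reversal, it passes through the signs and merely
  reparametrizes the line, while \<open>s\<close> moves the active coordinates and \<open>B\<close>
  twists the directions.\<close>

lemma cube_map_lp:
  assumes s: "s permutes I" and p: "p \<in> sym_perms n" and x: "x \<in> C" "S \<subseteq> I" "t < n"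
  shows "cube_map s B p (lp x S A t) = lp (cube_map s B p x) {i \<in> I. s i \<in> S} {i. (i \<in> B) \<noteq> (s i \<in> A)} (p t)"
proof (rule C_ext[OF cube_map_in_C[OF s p lp_in_C[OF x]] lp_in_C[OF cube_map_in_C[OF s p x(1)] _ sym_permsD(2)[OF p x(3)]]])
  fix i assume i: "i \<in> I"
  then show "cube_map s B p (lp x S A t) i = lp (cube_map s B p x) {i \<in> I. s i \<in> S} {i. (i \<in> B) \<noteq> (s i \<in> A)} (p t) i"
    using x lp_in_C[OF x] sym_perms_sg[OF p x(3), of A] sym_permsD(2)[OF p x(3)]
    by (auto simp: cube_map_apply lp_def sg_def)
qed auto

lemma cube_map_line:
  assumes s: "s permutes I" and p: "p \<in> sym_perms n" and L: "line L"
  shows "line (cube_map s B p ` L)"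
proof -
  obtain x S A where x: "x \<in> C" "S \<subseteq> I" "S \<noteq> {}" and Ls: "L = lp x S A ` {..<n}"
    using L unfolding line_iff by blast
  let ?S = "{i \<in> I. s i \<in> S}" and ?A = "{i. (i \<in> B) \<noteq> (s i \<in> A)}"
  have "cube_map s B p ` L = lp (cube_map s B p x) ?S ?A ` p ` {..<n}"
    unfolding Ls image_image using cube_map_lp[OF s p x(1,2)] by (intro image_cong) auto
  also have "p ` {..<n} = {..<n}" using sym_permsD(1)[OF p] by (rule permutes_image)
  finally show ?thesis
  proof (subst line_iff, intro exI conjI)
    obtain j where "j \<in> S" using x by blast
    then obtain i where "i \<in> I" "j = s i" using permutes_image[OF s] x by blast
    then show "?S \<noteq> {}" using \<open>j \<in> S\<close> by blast
  qed (use cube_map_in_C s p x in auto)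
qed

lemma line_group_carrier: "f \<in> carrier (line_group n d) \<longleftrightarrow> f \<in> Bij C \<and> (\<forall>L. line L \<longrightarrow> line (f ` L))"
  by (simp add: line_group_def)

lemma cube_map_line_group:
  "s permutes I \<Longrightarrow> p \<in> sym_perms n \<Longrightarrow> cube_map s B p \<in> carrier (line_group n d)"
  using cube_map_Bij cube_map_line line_group_carrier by blast

text \<open>There are finitely many lines, so the injective map that \<open>f\<close> induces on
  them is onto; a set whose image is a line is therefore a line itself.\<close>

lemma line_group_aut:
  assumes "f \<in> carrier (line_group n d)"
  shows "aut f"
proof -
  have b: "bij_betw f C C" and l: "\<And>L. line L \<Longrightarrow> line (f ` L)"
    using assms by (auto simp: line_group_carrier Bij_def)
  let ?L = "{L. line L}"
  have fin: "finite ?L" by (rule finite_subset[of _ "Pow C"]) (auto simp: finite_cube dest: line_subset)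
  have injP: "inj_on (image f) (Pow C)" using b by (simp add: bij_betw_def inj_on_image_Pow)
  then have inj: "inj_on (image f) ?L" by (rule inj_on_subset) (auto dest: line_subset)
  have "image f ` ?L = ?L" using l by (intro endo_inj_surj[OF fin _ inj]) auto
  then have *: "\<exists>K. line K \<and> M = f ` K" if "line M" for M using that by (metis (mono_tags, lifting) imageE mem_Collect_eq)
  have "line L" if L: "L \<subseteq> C" "line (f ` L)" for L
  proof -
    obtain K where "line K" "f ` L = f ` K" using *[OF L(2)] by blast
    then show ?thesis using inj_onD[OF injP, of L K] L(1) line_subset by auto
  qed
  then show ?thesis unfolding aut_def using b l by blast
qed

lemma cube_map_aut: "s permutes I \<Longrightarrow> p \<in> sym_perms n \<Longrightarrow> aut (cube_map s B p)"
  using cube_map_line_group line_group_aut by blast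

section \<open>The induced map on a main diagonal\<close>

lemma zero_level: "0 < n" "0 \<noteq> rv 0"
  using n3 by (auto simp: rv_def)

text \<open>The image is a main diagonal, which yields \<open>B\<close> and a permutation
  \<open>p\<close> of the parameters. That \<open>p\<close> commutes with reversal is seen from a
  point on another diagonal that is collinear with the points of parameters \<open>t\<close> and
  \<open>rv t\<close>.\<close>

lemma aut_main_diagonal:
  assumes f: "aut f"
  obtains B p where "B \<subseteq> I" "p \<in> sym_perms n" "\<And>t. t < n \<Longrightarrow> f (pt {} t) = pt B (p t)"
proof -
  have "f ` (pt {} ` {..<n}) \<subseteq> diag"
  proof -
    have "pt {} t \<in> diag" if "t < n" for t using that unfolding diag_def by blast
    then show ?thesis using aut_diag[OF f] by blast
  qed
  then obtain B where B: "B \<subseteq> I" "f ` (pt {} ` {..<n}) = pt B ` {..<n}"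
    using line_subset_diag[OF aut_line[OF f line_diagonal]] by metis
  \<comment> \<open>Coordinate 1, freed from its sign, reads off the parameter on the image
    diagonal; beyond \<open>n\<close> the identity is used so that \<open>p\<close> can be a
    permutation of {0, ..., n - 1}.\<close>
  define p where "p t = (if t < n then sg B 1 (f (pt {} t) 1) else t)" for t
  have p: "f (pt {} t) = pt B (p t)" "p t < n" if t: "t < n" for t
  proof -
    obtain u where u: "u < n" "f (pt {} t) = pt B u" using B(2) t by blast
    then have "p t = u" using t one_in_I by (simp add: p_def pt_apply)
    then show "f (pt {} t) = pt B (p t)" "p t < n" using u by auto
  qed
  have inj: "s = t" if "s < n" "t < n" "p s = p t" for s t
  proof -
    have "f (pt {} s) = f (pt {} t)" using p that by metis
    then have "pt {} s = pt {} t" using aut_eq[OF f] that by simp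
    then have "pt {} s 1 = pt {} t 1" by simp
    then show ?thesis using one_in_I by (simp add: pt_apply sg_def)
  qed
  have "p ` {..<n} = {..<n}" by (rule endo_inj_surj) (use p inj in \<open>auto intro: inj_onI\<close>)
  then have perm: "p permutes {..<n}"
    by (intro bij_imp_permutes) (use inj in \<open>auto simp: bij_betw_def p_def intro!: inj_onI\<close>)
  have noncentral_diag: "pt A u \<in> noncentral_diag \<longleftrightarrow> u \<noteq> rv u" if "u < n" for A u
  proof -
    have "pt A u \<in> diag" using that unfolding diag_iff by (auto simp: pt_apply sg_def)
    then show ?thesis unfolding noncentral_diag_iff using one_in_I that by (auto simp: pt_apply sg_def)
  qed
  have mid: "p t = rv (p t) \<longleftrightarrow> t = rv t" if "t < n" for t
    using aut_noncentral_diag[OF f, of "pt {} t"] noncentral_diag[of t] noncentral_diag[of "p t" B] p[OF that] that by simp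
  have "p (rv t) = rv (p t)" if t: "t < n" for t
  proof (cases "t = rv t")
    case False
    \<comment> \<open>The test point \<open>pt {1} t\<close> is off the diagonal
      \<open>pt {}\<close>, as its first two coordinates differ. The level of its image must match
      that of \<open>p t\<close> and that of \<open>p (rv t)\<close>.\<close>
    have "f (pt {1} t) \<in> noncentral_diag" using aut_noncentral_diag f noncentral_diag False t by simp
    then obtain A u where A: "A \<subseteq> I" "u < n" "u \<noteq> rv u" "f (pt {1} t) = pt A u" by (auto simp: noncentral_diag_def)
    have nin: "pt {1} t \<notin> pt {} ` {..<n}"
    proof
      assume "pt {1} t \<in> pt {} ` {..<n}"
      then obtain v where "pt {1} t = pt {} v" by blast
      then have "pt {1} t 1 = pt {} v 1" "pt {1} t 2 = pt {} v 2" by simp_all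
      then show False using one_in_I two_in_I False by (simp add: pt_apply sg_def)
    qed
    then have nin': "pt A u \<notin> pt B ` {..<n}"
      using aut_mem[OF f, of "pt {} ` {..<n}" "pt {1} t"] A B t line_subset[OF line_diagonal] by simp
    have AB: "A \<noteq> B" "A \<noteq> I - B" using nin' A pt_compl[of u B] by auto
    have "u = p v \<or> u = rv (p v)" if v: "v = t \<or> v = rv t" for v
    proof (rule coll_pt_imp_same_level[of B A])
      have vn: "v < n" "v \<noteq> rv v" using v t False by auto
      show "p v < n" "p v \<noteq> rv (p v)" using p mid vn by auto
      have "coll (pt {} v) (pt {1} t)" by (rule coll_pt_same_level) (use v t in auto)
      then have "coll (f (pt {} v)) (f (pt {1} t))" using aut_coll[OF f] vn t by simp
      then show "coll (pt B (p v)) (pt A u)" using p vn A by simp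
    qed (use A B AB in auto)
    then have "u = p t \<or> u = rv (p t)" "u = p (rv t) \<or> u = rv (p (rv t))" by auto
    moreover have "p (rv t) \<noteq> p t" using inj[of "rv t" t] t False by auto
    ultimately show ?thesis using p(2) t by (metis rv_less rv_rv)
  qed (use mid that in metis)
  then have "p \<in> sym_perms n" using perm by (intro sym_permsI) auto
  then show thesis using that B p by blast
qed

subsection \<open>The action on the corners\<close>

lemma pt_neq:
  assumes "A \<subseteq> I" "B \<subseteq> I" "A \<noteq> B"
  shows "pt A 0 \<noteq> pt B 0"
  using pt_eq_iff[of A B 0 0] assms zero_level by auto

text \<open>Any two corners span a line, active where their sign sets differ. With the signs
  \<open>A\<close>, parameter 0 gives the first corner and \<open>rv 0\<close> the second.\<close>

lemma span_corner:
  assumes AB: "A \<subseteq> I" "B \<subseteq> I" "A \<noteq> B"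
  shows "span (pt A 0) (pt B 0) = lp (pt A 0) (sdiff A B) A ` {..<n}"
    and "lp (pt A 0) (sdiff A B) A (rv 0) = pt B 0"
proof -
  have S: "sdiff A B \<subseteq> I" using AB by (auto simp: sdiff_def)
  have P: "pt A 0 \<in> C" using zero_level by simp
  show e: "lp (pt A 0) (sdiff A B) A (rv 0) = pt B 0"
    by (rule C_ext[OF lp_in_C[OF P S]])
       (use zero_level in \<open>auto simp: lp_pt_apply pt_apply sg_def sdiff_def\<close>)
  show "span (pt A 0) (pt B 0) = lp (pt A 0) (sdiff A B) A ` {..<n}"
    using span_lp[OF P S, of 0 "rv 0" A] e lp_pt_self[OF S, of A 0] zero_level by simp
qed

text \<open>This makes the order structure of the corners, relative to any base corner \<open>A\<close>, visible to
  collinearity.\<close>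

lemma comparable_iff:
  assumes ABD: "A \<subseteq> I" "B \<subseteq> I" "D \<subseteq> I" "A \<noteq> B" "A \<noteq> D" "B \<noteq> D"
  shows "(sdiff A B \<subseteq> sdiff A D \<or> sdiff A D \<subseteq> sdiff A B) \<longleftrightarrow>
    (\<exists>X\<in>span (pt A 0) (pt B 0). \<exists>Y\<in>span (pt A 0) (pt D 0).
       X \<noteq> pt A 0 \<and> X \<noteq> pt B 0 \<and> Y \<noteq> pt A 0 \<and> Y \<noteq> pt D 0 \<and> coll X Y)"
proof -
  let ?P = "pt A 0" and ?S = "sdiff A B" and ?T = "sdiff A D"
  have S: "?S \<subseteq> I" "?T \<subseteq> I" using ABD by (auto simp: sdiff_def)
  obtain i j where ij: "i \<in> ?S" "j \<in> ?T" using ABD by (auto simp: sdiff_def)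
  have sp: "span ?P (pt B 0) = lp ?P ?S A ` {..<n}" "span ?P (pt D 0) = lp ?P ?T A ` {..<n}"
    using span_corner ABD by auto
  have ends: "lp ?P ?S A (rv 0) = pt B 0" "lp ?P ?T A (rv 0) = pt D 0" "lp ?P ?S A 0 = ?P" "lp ?P ?T A 0 = ?P"
    using span_corner(2) lp_pt_self S ABD by auto
  show ?thesis
  proof
    assume c: "?S \<subseteq> ?T \<or> ?T \<subseteq> ?S"
    \<comment> \<open>Since \<open>n\<close> is at least 3, parameter 1 lies strictly between the
      two corners of each line.\<close>
    have one: "1 < n" "1 \<noteq> (0::nat)" "1 \<noteq> rv 0" using n3 by (auto simp: rv_def)
    have "lp ?P ?S A 1 \<noteq> ?P" "lp ?P ?S A 1 \<noteq> pt B 0"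
      using lp_inj[OF ij(1) one(1), of _ ?P A] ends one zero_level(1) rv_less by metis+
    moreover have "lp ?P ?T A 1 \<noteq> ?P" "lp ?P ?T A 1 \<noteq> pt D 0"
      using lp_inj[OF ij(2) one(1), of _ ?P A] ends one zero_level(1) rv_less by metis+
    moreover have "coll (lp ?P ?S A 1) (lp ?P ?T A 1)"
      by (rule coll_lp_same) (use c S one zero_level in auto)
    ultimately show "\<exists>X\<in>span ?P (pt B 0). \<exists>Y\<in>span ?P (pt D 0).
       X \<noteq> ?P \<and> X \<noteq> pt B 0 \<and> Y \<noteq> ?P \<and> Y \<noteq> pt D 0 \<and> coll X Y"
      unfolding sp using one(1) by blast
  next
    assume "\<exists>X\<in>span ?P (pt B 0). \<exists>Y\<in>span ?P (pt D 0).
       X \<noteq> ?P \<and> X \<noteq> pt B 0 \<and> Y \<noteq> ?P \<and> Y \<noteq> pt D 0 \<and> coll X Y"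
    then obtain s t where st: "s < n" "t < n" and ne: "lp ?P ?S A s \<noteq> ?P" "lp ?P ?S A s \<noteq> pt B 0" "lp ?P ?T A t \<noteq> ?P"
      and c: "coll (lp ?P ?S A s) (lp ?P ?T A t)" unfolding sp by blast
    \<comment> \<open>For incomparable sets collinearity would force \<open>s = rv 0\<close>, that
      is, the excluded corner \<open>pt B 0\<close>.\<close>
    have "s \<noteq> 0" "s \<noteq> rv 0" "t \<noteq> 0" using ne ends by auto
    then show "?S \<subseteq> ?T \<or> ?T \<subseteq> ?S"
      using coll_lp_incomparable[OF zero_level st S _ _ _ _ c] by blast
  qed
qed

lemma coll_corners: "coll (pt A 0) (pt B 0)"
  by (rule coll_pt_same_level) (use zero_level in auto)

lemma aut_comparable:
  assumes f: "aut f" and ABD: "A \<subseteq> I" "B \<subseteq> I" "D \<subseteq> I" "A' \<subseteq> I" "B' \<subseteq> I" "D' \<subseteq> I"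
    and im: "f (pt A 0) = pt A' 0" "f (pt B 0) = pt B' 0" "f (pt D 0) = pt D' 0"
  shows "(sdiff A' B' \<subseteq> sdiff A' D' \<or> sdiff A' D' \<subseteq> sdiff A' B') \<longleftrightarrow>
    (sdiff A B \<subseteq> sdiff A D \<or> sdiff A D \<subseteq> sdiff A B)"
proof -
  have pC: "pt K 0 \<in> C" for K using zero_level by simp
  have eq: "K = L \<longleftrightarrow> pt K 0 = pt L 0" if "K \<subseteq> I" "L \<subseteq> I" for K L using pt_neq that by blast
  have eqs: "A' = B' \<longleftrightarrow> A = B" "A' = D' \<longleftrightarrow> A = D" "B' = D' \<longleftrightarrow> B = D"
    using eq ABD im aut_eq[OF f pC pC] by metis+
  show ?thesis
  \<comment> \<open>If two of the sets coincide, both comparability statements hold trivially, while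
    the spans would degenerate.\<close>
  proof (cases "A = B \<or> A = D \<or> B = D")
    case True
    then show ?thesis using eqs by (auto simp: sdiff_def)
  next
    case False
    have sp: "span (pt A' 0) (pt B' 0) = f ` span (pt A 0) (pt B 0)" "span (pt A' 0) (pt D' 0) = f ` span (pt A 0) (pt D 0)"
      using aut_span[OF f pC pC _ coll_corners] im pt_neq ABD False by metis+
    have sub: "span X Y \<subseteq> C" for X Y by (auto simp: span_def)
    have 1: "(f X \<noteq> pt A' 0 \<and> f X \<noteq> pt B' 0 \<and> f Y \<noteq> pt A' 0 \<and> f Y \<noteq> pt D' 0 \<and> coll (f X) (f Y)) \<longleftrightarrow>
      (X \<noteq> pt A 0 \<and> X \<noteq> pt B 0 \<and> Y \<noteq> pt A 0 \<and> Y \<noteq> pt D 0 \<and> coll X Y)"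
      if "X \<in> span (pt A 0) (pt B 0)" "Y \<in> span (pt A 0) (pt D 0)" for X Y
    proof -
      have "X \<in> C" "Y \<in> C" using that sub by blast+
      then show ?thesis unfolding im[symmetric] using aut_coll[OF f] aut_eq[OF f _ pC] by simp
    qed
    have "A' \<noteq> B'" "A' \<noteq> D'" "B' \<noteq> D'" "A \<noteq> B" "A \<noteq> D" "B \<noteq> D" using False eqs by auto
    then show ?thesis using 1 ABD unfolding comparable_iff[OF ABD(4-6) \<open>A' \<noteq> B'\<close> \<open>A' \<noteq> D'\<close> \<open>B' \<noteq> D'\<close>]
      comparable_iff[OF ABD(1-3) \<open>A \<noteq> B\<close> \<open>A \<noteq> D\<close> \<open>B \<noteq> D\<close>] sp bex_simps(7)
      by (intro bex_cong refl) (rule 1)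
  qed
qed

text \<open>All corners are collinear with the fixed corner \<open>pt {} 0\<close>, so their images
  stay at the level of 0 and are corners. The induced map on sign sets preserves comparability from
  every base corner, hence inclusion.\<close>

lemma aut_corners:
  assumes g: "aut g" and fix0: "\<And>t. t < n \<Longrightarrow> g (pt {} t) = pt {} t"
  obtains \<tau> where "\<tau> permutes I" "\<And>A. A \<subseteq> I \<Longrightarrow> g (pt A 0) = pt {i \<in> I. \<tau> i \<in> A} 0"
proof -
  have pC: "pt K 0 \<in> C" for K using zero_level by simp
  have ex: "\<exists>B\<subseteq>I. g (pt A 0) = pt B 0" if A: "A \<subseteq> I" for A
  proof (cases "A = {} \<or> A = I")
    case True
    have "pt I 0 = pt {} (rv 0)" using pt_compl[of 0 "{}"] zero_level by simp
    then show ?thesis using True fix0[of 0] fix0[of "rv 0"] zero_level by auto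
  next
    case False
    have "pt A 0 \<in> noncentral_diag" unfolding noncentral_diag_def using A zero_level by blast
    then have "g (pt A 0) \<in> noncentral_diag" using aut_noncentral_diag[OF g pC] by blast
    then obtain B u where B: "B \<subseteq> I" "u < n" "u \<noteq> rv u" "g (pt A 0) = pt B u" by (auto simp: noncentral_diag_def)
    have nin: "pt B u \<noteq> pt {} t" if t: "t < n" for t
    proof
      assume "pt B u = pt {} t"
      then have "pt A 0 = pt {} t" using fix0[OF t] B aut_eq[OF g, of "pt A 0" "pt {} t"] t pC by simp
      then have "t = 0 \<and> A = {} \<or> t = rv 0 \<and> A = I"
        using pt_eq_iff[of "{}" A t 0] A t zero_level by auto
      then show False using False by auto
    qed
    have "{} \<noteq> B" "{} \<noteq> I - B" using nin[of u] nin[of "rv u"] B pt_compl[of "rv u" B] pt_compl[of u "{}"] by auto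
    moreover have "coll (pt {} 0) (pt B u)"
      using aut_coll[OF g pC pC, of "{}" A] coll_corners fix0[of 0] zero_level B by simp
    ultimately have "u = 0 \<or> u = rv 0"
      using coll_pt_imp_same_level[of "{}" B 0 u] B zero_level by auto
    then show ?thesis
    proof
      assume "u = rv 0"
      then have "g (pt A 0) = pt (I - B) 0" using B pt_compl[of 0 B] zero_level by simp
      then show ?thesis by blast
    qed (use B in blast)
  qed
  define phi where "phi A = (SOME B. B \<subseteq> I \<and> g (pt A 0) = pt B 0)" for A
  have phi: "phi A \<subseteq> I" "g (pt A 0) = pt (phi A) 0" if "A \<subseteq> I" for A
    using someI_ex[OF ex[OF that, unfolded Bex_def]] by (auto simp: phi_def)
  have phi_inj: "A = B" if "A \<subseteq> I" "B \<subseteq> I" "phi A = phi B" for A B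
    using phi that aut_eq[OF g pC pC] pt_neq by metis
  have inj: "inj_on phi (Pow I)" by (rule inj_onI) (rule phi_inj, auto)
  have "phi ` Pow I = Pow I" by (rule endo_inj_surj[OF _ _ inj]) (use phi in auto)
  then have bij: "bij_betw phi (Pow I) (Pow I)" using inj by (simp add: bij_betw_def)
  have phi0: "phi {} = {}"
    using phi[of "{}"] fix0[of 0] zero_level pt_neq[of "phi {}" "{}"] by auto
  have comp: "(sdiff (phi A) (phi B) \<subseteq> sdiff (phi A) (phi D) \<or> sdiff (phi A) (phi D) \<subseteq> sdiff (phi A) (phi B)) \<longleftrightarrow>
    (sdiff A B \<subseteq> sdiff A D \<or> sdiff A D \<subseteq> sdiff A B)" if "A \<subseteq> I" "B \<subseteq> I" "D \<subseteq> I" for A B D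
    by (rule aut_comparable[OF g]) (use phi that in auto)
  have mono: "phi B \<subseteq> phi A \<longleftrightarrow> B \<subseteq> A" if AB: "B \<subseteq> I" "A \<subseteq> I" for A B
  proof (cases "A = {}")
    case True
    then show ?thesis using phi0 phi_inj[of B "{}"] AB by auto
  next
    case False
    then have "phi A \<noteq> {}" using phi_inj[of A "{}"] AB phi0 by auto
    then show ?thesis
      using subset_by_comparability[OF False, of B] subset_by_comparability[of "phi A" "phi B"]
        comp[of "{}" B A] comp[of A "{}" B] AB phi0 by simp
  qed
  obtain \<sigma> where \<sigma>: "bij_betw \<sigma> I I" "\<And>A. A \<subseteq> I \<Longrightarrow> phi A = \<sigma> ` A"
    using order_automorphism_Pow[OF bij mono] by blast
  \<comment> \<open>The inverse of the permutation is needed because \<open>cube_map\<close> pulls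
    coordinates back: the preimage of \<open>A\<close> under the inverse is the image of
    \<open>A\<close>.\<close>
  define \<tau> where "\<tau> i = (if i \<in> I then inv_into I \<sigma> i else i)" for i
  have "bij_betw \<tau> I I"
    using bij_betw_inv_into[OF \<sigma>(1)] by (rule bij_betw_cong[THEN iffD1, rotated]) (simp add: \<tau>_def)
  then have perm: "\<tau> permutes I" by (rule bij_imp_permutes) (auto simp: \<tau>_def)
  have "g (pt A 0) = pt {i \<in> I. \<tau> i \<in> A} 0" if A: "A \<subseteq> I" for A
  proof -
    have "\<sigma> ` A = {i \<in> I. \<tau> i \<in> A}"
    proof (intro equalityI subsetI)
      fix j assume "j \<in> \<sigma> ` A"
      then obtain i where i: "i \<in> A" "j = \<sigma> i" by blast
      moreover have "j \<in> I" using i A bij_betwE[OF \<sigma>(1)] by blast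
      moreover have "inv_into I \<sigma> j = i" using i A \<sigma>(1) by (auto simp: bij_betw_def)
      ultimately show "j \<in> {i \<in> I. \<tau> i \<in> A}" by (simp add: \<tau>_def)
    next
      fix j assume j: "j \<in> {i \<in> I. \<tau> i \<in> A}"
      then have "\<sigma> (\<tau> j) = j" using \<sigma>(1) by (auto simp: \<tau>_def bij_betw_inv_into_right)
      then show "j \<in> \<sigma> ` A" using j by (metis (mono_tags, lifting) imageI mem_Collect_eq)
    qed
    then show ?thesis using phi(2)[OF A] \<sigma>(2)[OF A] by simp
  qed
  then show thesis using that perm by blast
qed

subsection \<open>Rigidity\<close>

text \<open>Both ends of the diagonal \<open>pt A\<close> are fixed, so it is mapped to itself, and
  collinearity with the fixed point \<open>pt {} t\<close> keeps the level. It remains to exclude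
  that \<open>pt A t\<close> is sent to \<open>pt A (rv t)\<close>.\<close>

lemma aut_fixes_diag:
  assumes g: "aut g" and fix_diag: "\<And>t. t < n \<Longrightarrow> g (pt {} t) = pt {} t"
    and fix_corner: "\<And>A. A \<subseteq> I \<Longrightarrow> g (pt A 0) = pt A 0" and A: "A \<subseteq> I" and t: "t < n"
  shows "g (pt A t) = pt A t"
proof -
  consider "t = rv t" | "A = {}" | "A = I" | "t = 0" | "t \<noteq> rv t" "A \<noteq> {}" "A \<noteq> I" "t \<noteq> 0" by blast
  then show ?thesis
  proof cases
    case 1
    then have "pt A t = pt {} t" by (auto simp: pt_def sg_def)
    then show ?thesis using fix_diag t by simp
  next
    case 3
    then have "pt A t = pt {} (rv t)" using pt_compl[OF t, of "{}"] by simp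
    then show ?thesis using fix_diag by simp
  next
    case 5
    have "pt A (rv 0) = pt (I - A) 0" using pt_compl zero_level by simp
    then have fr: "g (pt A (rv 0)) = pt A (rv 0)" using fix_corner[of "I - A"] by simp
    have dC: "pt A ` {..<n} \<subseteq> C" by (rule line_subset[OF line_diagonal])
    have "pt A 0 \<noteq> pt A (rv 0)" using pt_eq_iff[of A A "rv 0" 0] A zero_level 5 by auto
    then have "g ` (pt A ` {..<n}) = pt A ` {..<n}"
      using line_unique[OF aut_line[OF g line_diagonal] line_diagonal, of "pt A 0" A "pt A (rv 0)" A]
        fr fix_corner[OF A] zero_level by (metis imageI lessThan_iff rv_less)
    then obtain u where u: "u < n" "g (pt A t) = pt A u" using t by blast
    have "pt A t \<in> noncentral_diag" unfolding noncentral_diag_def using A t 5 by blast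
    then have "pt A u \<in> noncentral_diag" using aut_noncentral_diag[OF g, of "pt A t"] u t by simp
    then have "sg A 1 u \<noteq> rv (sg A 1 u)" using one_in_I by (simp add: noncentral_diag_iff pt_apply)
    then have un: "u \<noteq> rv u" by (metis sg_def)
    have "coll (pt {} t) (pt A t)" by (rule coll_pt_same_level) (use t in auto)
    then have "coll (pt {} t) (pt A u)" using aut_coll[OF g, of "pt {} t" "pt A t"] t u fix_diag by simp
    then have "u = t \<or> u = rv t" using coll_pt_imp_same_level[of "{}" A t u] A t u un 5 by auto
    moreover have "u \<noteq> rv t"
    proof
      assume ur: "u = rv t"
      \<comment> \<open>\<open>X\<close> is the intersection of a line through two fixed corners, on
        which the coordinates in \<open>A\<close> are 0, with the line joining
        \<open>pt {} t\<close> and \<open>pt A t\<close>. If the latter point were reflected, the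
        image line would have constant value \<open>t\<close> on \<open>A\<close>, so the image of
        \<open>X\<close> would need both values there.\<close>
      define X where "X = (\<lambda>i\<in>I. if i \<in> A then 0 else t)"
      have XC: "X \<in> C" unfolding X_def using t by (intro restrict_in_C) auto
      obtain i where i: "i \<in> A" "i \<in> I" using 5 A by blast
      have X1: "X \<in> span (pt {} 0) (pt (I - A) 0)" unfolding span_def
        using XC zero_level by (auto simp: X_def pt_apply sg_def split: if_splits)
      have X2: "X \<in> span (pt {} t) (pt A t)" unfolding span_def
        using XC 5 by (auto simp: X_def pt_apply sg_def split: if_splits)
      have ne: "pt {} 0 \<noteq> pt (I - A) 0" using pt_neq[of "{}" "I - A"] 5 A by auto
      have "g ` span (pt {} 0) (pt (I - A) 0) = span (pt {} 0) (pt (I - A) 0)"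
        using aut_span[OF g _ _ ne coll_corners] fix_corner[of "{}"] fix_corner[of "I - A"] zero_level by simp
      then have "g X \<in> span (pt {} 0) (pt (I - A) 0)" using X1 by blast
      then have "g X i = 0" using i by (auto simp: span_def pt_apply sg_def)
      moreover have "pt {} t \<noteq> pt A t" using pt_eq_iff[of "{}" A t t] 5 A t by auto
      then have "g ` span (pt {} t) (pt A t) = span (pt {} t) (pt A u)"
        using aut_span[OF g _ _ _ \<open>coll (pt {} t) (pt A t)\<close>] t u fix_diag by simp
      then have "g X \<in> span (pt {} t) (pt A u)" using X2 by blast
      then have "g X i = t" using i t ur by (auto simp: span_def pt_apply sg_def)
      ultimately show False using 5 by simp
    qed
    ultimately show ?thesis using u by simp
  qed (use fix_diag fix_corner t A in auto)
qed

text \<open>The smaller member names the pair {t, rv t}, so counting the values of \<open>lv\<close>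
  on a point counts the pairs that its coordinates meet.\<close>

definition lv :: "nat \<Rightarrow> nat" where "lv t = min t (rv t)"

lemma lv_eq_iff: "s < n \<Longrightarrow> t < n \<Longrightarrow> lv s = lv t \<longleftrightarrow> s = t \<or> s = rv t"
  by (auto simp: lv_def rv_def min_def split: if_splits)

lemma lv_sg: "t < n \<Longrightarrow> lv (sg A i t) = lv t"
  by (auto simp: lv_def sg_def)

lemma merge_level:
  assumes x: "x \<in> C" and ij: "i \<in> I" "j \<in> I" "lv (x i) \<noteq> lv (x j)"
  defines "S \<equiv> {k \<in> I. lv (x k) = lv (x j)}" and "A \<equiv> {k. x k \<noteq> x j}"
  shows "lp x S A (x j) = x"
    and "v < n \<Longrightarrow> lv v = lv (x i) \<Longrightarrow> card ((\<lambda>k. lv (lp x S A v k)) ` I) < card ((\<lambda>k. lv (x k)) ` I)"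
proof -
  have S: "S \<subseteq> I" by (auto simp: S_def)
  show "lp x S A (x j) = x"
  proof (rule lp_self[OF S])
    fix k assume "k \<in> S"
    then have "x k = x j \<or> x k = rv (x j)" using lv_eq_iff[of "x k" "x j"] C_less[OF x] ij by (auto simp: S_def)
    then show "x k = sg A k (x j)" unfolding sg_def A_def mem_Collect_eq by presburger
  qed
  assume v: "v < n" "lv v = lv (x i)"
  show "card ((\<lambda>k. lv (lp x S A v k)) ` I) < card ((\<lambda>k. lv (x k)) ` I)"
  proof (rule psubset_card_mono)
    have "lv (lp x S A v k) \<in> (\<lambda>k. lv (x k)) ` I - {lv (x j)}" if "k \<in> I" for k
      using that ij v by (auto simp: lp_def lv_sg S_def)
    then have "(\<lambda>k. lv (lp x S A v k)) ` I \<subseteq> (\<lambda>k. lv (x k)) ` I - {lv (x j)}" by (rule image_subsetI)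
    also have "\<dots> \<subset> (\<lambda>k. lv (x k)) ` I" using imageI[OF ij(2), of "\<lambda>k. lv (x k)"] by blast
    finally show "(\<lambda>k. lv (lp x S A v k)) ` I \<subset> (\<lambda>k. lv (x k)) ` I" .
  qed simp
qed

text \<open>Off the diagonals, merging one level into another in two ways leads to two points that
  are fixed by induction, so a line through \<open>x\<close> is mapped to itself. A third fixed
  point collinear with \<open>x\<close> then determines the image of \<open>x\<close> on that
  line.\<close>

lemma aut_rigid:
  assumes g: "aut g" and fix_diag: "\<And>t. t < n \<Longrightarrow> g (pt {} t) = pt {} t"
    and fix_corner: "\<And>A. A \<subseteq> I \<Longrightarrow> g (pt A 0) = pt A 0" and x: "x \<in> C"
  shows "g x = x"
  using x
proof (induction "card ((\<lambda>k. lv (x k)) ` I)" arbitrary: x rule: less_induct)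
  case less
  note x = less.prems
  have IH: "g y = y" if "y \<in> C" "card ((\<lambda>k. lv (y k)) ` I) < card ((\<lambda>k. lv (x k)) ` I)" for y
    using less.hyps that by blast
  show ?case
  proof (cases "x \<in> diag")
    case True
    then show ?thesis using aut_fixes_diag[OF g fix_diag fix_corner] by (auto simp: diag_def)
  next
    case False
    then obtain i0 j0 where ij0: "i0 \<in> I" "j0 \<in> I" "x i0 \<noteq> x j0" "x i0 \<noteq> rv (x j0)" using x diag_iff by blast
    have l: "x k < n" if "k \<in> I" for k using C_less x that by blast
    have ne0: "lv (x i0) \<noteq> lv (x j0)" using lv_eq_iff ij0 l by blast
    \<comment> \<open>There is at most one middle value, so \<open>i\<close> can be chosen off the
      middle level; this makes the parameters \<open>x i\<close> and \<open>rv (x i)\<close>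
      distinct.\<close>
    have "x i0 \<noteq> rv (x i0) \<or> x j0 \<noteq> rv (x j0)" using ij0 l[of i0] l[of j0] by (auto simp: rv_def)
    then obtain i j where ij: "i \<in> I" "j \<in> I" "lv (x i) \<noteq> lv (x j)" "x i \<noteq> rv (x i)"
      using ij0 ne0 by metis
    define S A where "S = {k \<in> I. lv (x k) = lv (x j)}" and "A = {k. x k \<noteq> x j}"
    define T B where "T = {k \<in> I. lv (x k) = lv (x i)}" and "B = {k. x k \<noteq> x i}"
    have S: "S \<subseteq> I" "j \<in> S" "i \<notin> S" "T \<subseteq> I" "i \<in> T" "j \<notin> T" "j \<notin> A" "i \<notin> B"
      using ij by (auto simp: S_def T_def A_def B_def)
    have xS: "lp x S A (x j) = x" and xT: "lp x T B (x i) = x"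
      unfolding S_def A_def T_def B_def
      using merge_level(1)[OF x ij(1-3)] merge_level(1)[OF x ij(2,1) ij(3)[symmetric]] by simp_all
    have fixS: "g (lp x S A v) = lp x S A v" if v: "v = x i \<or> v = rv (x i)" for v
    proof (rule IH)
      have vn: "v < n" "lv v = lv (x i)" using v l ij lv_eq_iff by auto
      show "lp x S A v \<in> C" by (rule lp_in_C[OF x S(1) vn(1)])
      show "card ((\<lambda>k. lv (lp x S A v k)) ` I) < card ((\<lambda>k. lv (x k)) ` I)"
        unfolding S_def A_def by (rule merge_level(2)[OF x ij(1-3) vn])
    qed
    \<comment> \<open>Here the merging goes the other way: the level of \<open>x i\<close> is moved
      onto that of \<open>x j\<close>.\<close>
    define y where "y = lp x T B (x j)"
    have yC: "y \<in> C" unfolding y_def by (rule lp_in_C[OF x S(4) l[OF ij(2)]])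
    have fixy: "g y = y"
    proof (rule IH[OF yC])
      show "card ((\<lambda>k. lv (y k)) ` I) < card ((\<lambda>k. lv (x k)) ` I)"
        unfolding y_def T_def B_def by (rule merge_level(2)[OF x ij(2,1) ij(3)[symmetric] l[OF ij(2)] refl])
    qed
    have "coll x y"
    proof (rule line_imp_coll)
      show "line (lp x T B ` {..<n})" using S x by (intro line_lp) auto
      show "y \<in> lp x T B ` {..<n}" unfolding y_def using l ij by blast
      show "x \<in> lp x T B ` {..<n}" using l[OF ij(1)] xT by (metis imageI lessThan_iff)
    qed
    then have c: "coll (g x) y" using aut_coll[OF g x yC] fixy by simp
    let ?L = "lp x S A ` {..<n}"
    have L: "line ?L" using S x by (intro line_lp) auto
    have in_L: "lp x S A (x i) \<in> ?L" "lp x S A (rv (x i)) \<in> ?L" using l[OF ij(1)] by auto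
    have "lp x S A (x i) \<noteq> lp x S A (rv (x i))" using lp_inj[OF S(2)] l[OF ij(1)] ij(4) by simp
    moreover have "lp x S A (x i) \<in> g ` ?L" "lp x S A (rv (x i)) \<in> g ` ?L"
      using in_L fixS by (metis imageI)+
    ultimately have "g ` ?L = ?L" using line_unique[OF aut_line[OF g L] L] in_L by blast
    moreover have "x \<in> ?L" using l[OF ij(2)] xS by (metis imageI lessThan_iff)
    ultimately obtain v where v: "v < n" "g x = lp x S A v" by blast
    show ?thesis
    proof (cases "v = x j")
      case True
      then show ?thesis using v xS by simp
    next
      case False
      have gi: "g x i = x i" "g x j = v" "y i = x j" "y j = x j"
        using v S by (auto simp: y_def lp_def sg_def)
      have "x i \<noteq> x j" using ij by auto
      \<comment> \<open>At both \<open>i\<close> and \<open>j\<close> the point \<open>y\<close> has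
        the value \<open>x j\<close>, whereas \<open>g x\<close> has \<open>x i\<close> and
        \<open>v\<close>. So \<open>g x\<close> would be one of the two fixed points on the line,
        and by injectivity \<open>x\<close> would be that point.\<close>
      then have "x i = v \<or> x i = rv v" using collD[OF c ij(1,2)] gi False by auto
      then have "v = x i \<or> v = rv (x i)" using v by auto
      then have "g (lp x S A v) = g x" using fixS v by simp
      then have "lp x S A v = x" using aut_eq[OF g lp_in_C[OF x S(1) v(1)] x] by simp
      then show ?thesis using v by simp
    qed
  qed
qed

theorem aut_eq_cube_map:
  assumes f: "aut f"
  obtains s B p where "s permutes I" "B \<subseteq> I" "p \<in> sym_perms n" "\<And>x. x \<in> C \<Longrightarrow> f x = cube_map s B p x"
proof -
  obtain B p where B: "B \<subseteq> I" "p \<in> sym_perms n" "\<And>t. t < n \<Longrightarrow> f (pt {} t) = pt B (p t)"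
    using aut_main_diagonal[OF f] by blast
  \<comment> \<open>This map agrees with \<open>f\<close> on the diagonal \<open>pt {}\<close>;
    dividing by it fixes that diagonal, and dividing by \<open>cube_map \<tau> {} id\<close>
    afterwards fixes the corners too.\<close>
  have e: "aut (cube_map id B p)" by (rule cube_map_aut) (use B permutes_id in auto)
  obtain g where g: "aut g" "\<And>x. x \<in> C \<Longrightarrow> f x = cube_map id B p (g x)" using aut_factor[OF e f] by blast
  have g_diag: "g (pt {} t) = pt {} t" if t: "t < n" for t
  proof -
    have "cube_map id B p (pt {} t) = pt B (p t)"
    proof -
      have "{i \<in> I. (i \<in> B) \<noteq> (id i \<in> {})} = B" using B(1) by auto
      then show ?thesis using cube_map_pt[OF permutes_id B(2) t, of B "{}"] by simp
    qed
    then have "cube_map id B p (g (pt {} t)) = cube_map id B p (pt {} t)" using B(3)[OF t] g(2) t by simp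
    then show ?thesis using aut_eq[OF e] aut_C[OF g(1)] t by simp
  qed
  obtain \<tau> where \<tau>: "\<tau> permutes I" "\<And>A. A \<subseteq> I \<Longrightarrow> g (pt A 0) = pt {i \<in> I. \<tau> i \<in> A} 0"
    using aut_corners[OF g(1) g_diag] by blast
  have e': "aut (cube_map \<tau> {} id)" by (rule cube_map_aut[OF \<tau>(1) id_sym_perms])
  obtain h where h: "aut h" "\<And>x. x \<in> C \<Longrightarrow> g x = cube_map \<tau> {} id (h x)" using aut_factor[OF e' g(1)] by blast
  have eq: "h x = x" if "x \<in> C" "g x = cube_map \<tau> {} id x" for x
    using h that aut_eq[OF e'] aut_C[OF h(1)] by metis
  have h_diag: "h (pt {} t) = pt {} t" if t: "t < n" for t
    by (rule eq) (use t cube_map_pt[OF \<tau>(1) id_sym_perms t, of "{}" "{}"] g_diag in auto)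
  have h_corner: "h (pt A 0) = pt A 0" if A: "A \<subseteq> I" for A
    by (rule eq) (use A zero_level cube_map_pt[OF \<tau>(1) id_sym_perms zero_level(1), of "{}" A] \<tau>(2) in auto)
  have "f x = cube_map \<tau> B p x" if x: "x \<in> C" for x
  proof -
    have "h x = x" by (rule aut_rigid[OF h(1) h_diag h_corner x])
    then have "f x = cube_map id B p (cube_map \<tau> {} id x)" using g(2) h(2) x by simp
    also have "\<dots> = cube_map \<tau> B p x"
    proof (rule C_ext)
      have C': "cube_map \<tau> {} id x \<in> C" by (rule cube_map_in_C[OF \<tau>(1) id_sym_perms x])
      show "cube_map id B p (cube_map \<tau> {} id x) i = cube_map \<tau> B p x i" if "i \<in> I" for i
        using that C' x by (simp add: cube_map_apply sg_def)
      show "cube_map id B p (cube_map \<tau> {} id x) \<in> C" by (rule cube_map_in_C[OF permutes_id B(2) C'])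
      show "cube_map \<tau> B p x \<in> C" by (rule cube_map_in_C[OF \<tau>(1) B(2) x])
    qed
    finally show ?thesis .
  qed
  then show thesis using that \<tau>(1) B by blast
qed

subsection \<open>Counting\<close>

text \<open>Points with equal coordinates compare \<open>B\<close> and \<open>p\<close>
  independently of the permutation, and varying a single coordinate detects \<open>s\<close>.
  Reversing all signs can be absorbed into the value permutation, which is why \<open>p\<close> is
  recovered only once the signs at coordinate 1 agree.\<close>

lemma cube_map_eqD:
  assumes s: "s permutes I" "s' permutes I" and B: "B \<subseteq> I" "B' \<subseteq> I"
    and p: "p \<in> sym_perms n" "p' \<in> sym_perms n" and eq: "cube_map s B p = cube_map s' B' p'"
  shows "s = s'" and "(1 \<in> B) = (1 \<in> B') \<Longrightarrow> p = p'" and "p = p' \<Longrightarrow> B = B'"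
proof -
  have val: "sg B i (p (x (s i))) = sg B' i (p' (x (s' i)))" if "x \<in> C" "i \<in> I" for x i
    using fun_cong[OF fun_cong[OF eq, of x], of i] that by (simp add: cube_map_apply)
  have diag: "sg B i (p t) = sg B' i (p' t)" if "i \<in> I" "t < n" for i t
  proof -
    have "s i \<in> I" "s' i \<in> I" using permutes_I s that by auto
    then have "pt {} t (s i) = t" "pt {} t (s' i) = t" by (simp_all add: pt_apply sg_def)
    then show ?thesis using val[of "pt {} t" i] that by simp
  qed
  have si: "s i = s' i" if i: "i \<in> I" for i
  proof (rule ccontr)
    assume ne: "s i \<noteq> s' i"
    have si: "s i \<in> I" "s' i \<in> I" using i permutes_I s by auto
    \<comment> \<open>Only coordinate \<open>s i\<close> varies with \<open>t\<close>, so if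
      \<open>s' i\<close> were different, the left side would depend on \<open>t\<close> and the
      right side would not.\<close>
    have x: "lp (pt {} 0) {s i} {} t \<in> C" if "t < n" for t
      by (rule lp_in_C) (use zero_level si that in auto)
    have "sg B i (p t) = sg B' i (p' 0)" if "t < n" for t
      using val[OF x[OF that] i] ne si by (simp add: lp_def sg_def pt_apply)
    then have "sg B i (p 0) = sg B i (p 1)" using zero_level n3 by simp
    then show False using sym_permsD[OF p(1)] n3 by (simp add: sg_inj)
  qed
  show "s = s'"
  proof
    fix i show "s i = s' i"
      by (cases "i \<in> I") (use si permutes_not_in[OF s(1)] permutes_not_in[OF s(2)] in auto)
  qed
  show "p = p'" if one: "(1 \<in> B) = (1 \<in> B')"
  proof
    fix t show "p t = p' t"
    proof (cases "t < n")
      case True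
      then show ?thesis using diag[OF one_in_I True] one sym_permsD(2) p by (auto simp: sg_def rv_inj split: if_splits)
    next
      case False
      then show ?thesis using permutes_not_in[of p "{..<n}" t] permutes_not_in[of p' "{..<n}" t] sym_permsD(1) p by simp
    qed
  qed
  show "B = B'" if "p = p'"
  proof -
    have "p 0 \<noteq> rv (p 0)"
      using sym_permsD(3,4)[OF p(1)] zero_level by (metis rv_less)
    then have "(i \<in> B) = (i \<in> B')" if "i \<in> I" for i
      using diag[OF that zero_level(1)] \<open>p = p'\<close> by (auto simp: sg_def split: if_splits)
    then show ?thesis using B by blast
  qed
qed

definition rvp :: "nat \<Rightarrow> nat" where
  "rvp t = (if t < n then rv t else t)"

lemma rvp_sym: "rvp \<in> sym_perms n"
proof (rule sym_permsI)
  show "rvp permutes {..<n}"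
    by (rule bij_imp_permutes)
       (auto simp: rvp_def intro!: bij_betw_byWitness[where f' = rvp])
qed (auto simp: rvp_def)

text \<open>Supplies, for every map of this form, a representation with positive sign at coordinate
  1.\<close>

lemma cube_map_compl:
  assumes "s permutes I" "p \<in> sym_perms n"
  shows "cube_map s (I - B) (rvp \<circ> p) = cube_map s B p"
proof
  fix x show "cube_map s (I - B) (rvp \<circ> p) x = cube_map s B p x"
  proof (cases "x \<in> C")
    case True
    show ?thesis
    proof (rule C_ext)
      fix i assume i: "i \<in> I"
      then have "p (x (s i)) < n" using C_less[OF True] permutes_I[OF assms(1)] sym_permsD(2)[OF assms(2)] by blast
      then show "cube_map s (I - B) (rvp \<circ> p) x i = cube_map s B p x i"
        using i True by (simp add: cube_map_apply sg_def rvp_def)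
    qed (use True assms cube_map_in_C sym_perms_comp rvp_sym in auto)
  qed (simp add: cube_map_def)
qed

abbreviation signs :: "nat set set" where "signs \<equiv> Pow (I - {1})"
abbreviation perms :: "(nat \<Rightarrow> nat) set" where "perms \<equiv> {s. s permutes I}"

lemma line_group_parametrization:
  "bij_betw (\<lambda>(s, B, p). cube_map s B p) (perms \<times> signs \<times> sym_perms n) (carrier (line_group n d))"
proof (rule bij_betw_imageI)
  show "inj_on (\<lambda>(s, B, p). cube_map s B p) (perms \<times> signs \<times> sym_perms n)"
  proof (rule inj_onI)
    fix z w assume zw: "z \<in> perms \<times> signs \<times> sym_perms n" "w \<in> perms \<times> signs \<times> sym_perms n"
      "(\<lambda>(s, B, p). cube_map s B p) z = (\<lambda>(s, B, p). cube_map s B p) w"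
    obtain s B p s' B' p' where z: "z = (s, B, p)" "w = (s', B', p')" by (cases z, cases w) blast
    have A: "s permutes I" "B \<subseteq> I - {1}" "p \<in> sym_perms n"
      "s' permutes I" "B' \<subseteq> I - {1}" "p' \<in> sym_perms n" "cube_map s B p = cube_map s' B' p'" using zw by (simp_all add: z)
    note D = cube_map_eqD[OF A(1,4) _ _ A(3,6,7)]
    have B: "B \<subseteq> I" "B' \<subseteq> I" "1 \<notin> B" "1 \<notin> B'" using A by auto
    show "z = w" unfolding z using D(1)[OF B(1,2)] D(2)[OF B(1,2)] D(3)[OF B(1,2)] B(3,4) by simp
  qed
  show "(\<lambda>(s, B, p). cube_map s B p) ` (perms \<times> signs \<times> sym_perms n) = carrier (line_group n d)"
  proof (intro equalityI subsetI)
    fix f assume f: "f \<in> carrier (line_group n d)"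
    obtain s B p where s: "s permutes I" "B \<subseteq> I" "p \<in> sym_perms n" and eq: "\<And>x. x \<in> C \<Longrightarrow> f x = cube_map s B p x"
      using aut_eq_cube_map[OF line_group_aut[OF f]] by blast
    have "f \<in> extensional C" "cube_map s B p \<in> extensional C"
      using f cube_map_Bij[OF s(1,3)] by (auto simp: line_group_carrier Bij_def)
    then have fE: "f = cube_map s B p" using eq by (rule extensionalityI)
    show "f \<in> (\<lambda>(s, B, p). cube_map s B p) ` (perms \<times> signs \<times> sym_perms n)"
    proof (cases "1 \<in> B")
      case True
      have "f = cube_map s (I - B) (rvp \<circ> p)" using fE cube_map_compl s by simp
      moreover have "I - B \<in> signs" "rvp \<circ> p \<in> sym_perms n" using True sym_perms_comp rvp_sym s by auto
      ultimately show ?thesis using s(1) by force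
    next
      case False
      then show ?thesis using fE s by force
    qed
  qed (use cube_map_line_group in auto)
qed

lemma coord_map_eq_cube_map: "coord_map n d p = cube_map id {} p"
  by (auto simp: coord_map_def cube_map_def sg_def fun_eq_iff)

lemma card_coord_group: "card (carrier (coord_group n d)) = card (sym_perms n)"
proof -
  have "inj_on (coord_map n d) (sym_perms n)"
    by (rule inj_onI) (use cube_map_eqD(2)[OF permutes_id permutes_id, of "{}" "{}"] in \<open>simp add: coord_map_eq_cube_map\<close>)
  then show ?thesis by (simp add: coord_group_def card_image)
qed

section \<open>Rotations as signed permutations with a parity condition\<close>

definition signed_perm :: "(nat \<Rightarrow> nat) \<Rightarrow> nat set \<Rightarrow> (nat \<Rightarrow> nat) \<Rightarrow> nat \<Rightarrow> nat" where
  "signed_perm s B = cube_map s B id"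

lemma signed_perm_eqD:
  assumes "s permutes I" "s' permutes I" "B \<subseteq> I" "B' \<subseteq> I" "signed_perm s B = signed_perm s' B'"
  shows "s = s'" "B = B'"
  using cube_map_eqD(1,3)[OF assms(1-4) id_sym_perms id_sym_perms] assms(5) by (auto simp: signed_perm_def)

lemma signed_perm_Bij: "s permutes I \<Longrightarrow> signed_perm s B \<in> Bij C"
  using cube_map_Bij id_sym_perms by (simp add: signed_perm_def)

lemma signed_perm_mult:
  assumes s: "s permutes I" "s' permutes I"
  shows "signed_perm s B \<otimes>\<^bsub>BijGroup C\<^esub> signed_perm s' B' = signed_perm (s' \<circ> s) (sdiff B {i \<in> I. s i \<in> B'})"
proof -
  have "compose C (signed_perm s B) (signed_perm s' B') = signed_perm (s' \<circ> s) (sdiff B {i \<in> I. s i \<in> B'})"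
  proof
    fix x show "compose C (signed_perm s B) (signed_perm s' B') x = signed_perm (s' \<circ> s) (sdiff B {i \<in> I. s i \<in> B'}) x"
    proof (cases "x \<in> C")
      case True
      have yC: "cube_map s' B' id x \<in> C" using cube_map_in_C s id_sym_perms True by simp
      have "cube_map s B id (cube_map s' B' id x) = cube_map (s' \<circ> s) (sdiff B {i \<in> I. s i \<in> B'}) id x"
      proof (rule C_ext)
        fix i assume i: "i \<in> I"
        then have si: "s i \<in> I" "s' (s i) \<in> I" using permutes_I s by auto
        then have "x (s' (s i)) < n" using C_less True by blast
        then show "cube_map s B id (cube_map s' B' id x) i = cube_map (s' \<circ> s) (sdiff B {i \<in> I. s i \<in> B'}) id x i"
          using i si True yC by (simp add: cube_map_apply sg_def sdiff_def)
      next
        show "cube_map s B id (cube_map s' B' id x) \<in> C" by (rule cube_map_in_C[OF s(1) id_sym_perms yC])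
        show "cube_map (s' \<circ> s) (sdiff B {i \<in> I. s i \<in> B'}) id x \<in> C"
          by (rule cube_map_in_C[OF permutes_compose[OF s] id_sym_perms True])
      qed
      then show ?thesis using True by (simp add: compose_def signed_perm_def)
    qed (simp add: compose_def signed_perm_def cube_map_def)
  qed
  then show ?thesis using signed_perm_Bij s by (simp add: BijGroup_def)
qed

lemma signed_perm_id: "signed_perm id {} = \<one>\<^bsub>BijGroup C\<^esub>"
  using coord_map_eq_cube_map[of id] coord_map_id by (simp add: signed_perm_def BijGroup_def)

lemma rot_eq_signed_perm:
  assumes "i \<in> I" "j \<in> I" "i \<noteq> j"
  shows "rot n d i j = signed_perm (transpose i j) {i}"
proof
  fix x show "rot n d i j x = signed_perm (transpose i j) {i} x"
  proof (cases "x \<in> C")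
    case True
    have p: "transpose i j permutes I" using assms by (simp add: permutes_swap_id)
    have "rot n d i j x \<in> C" using rot_in_Bij[OF assms] True by (auto simp: Bij_def bij_betw_def)
    moreover have "signed_perm (transpose i j) {i} x \<in> C" unfolding signed_perm_def using cube_map_in_C p id_sym_perms True by simp
    ultimately show ?thesis
    proof (rule C_ext)
      show "rot n d i j x k = signed_perm (transpose i j) {i} x k" if "k \<in> I" for k
        using that True assms unfolding rot_def signed_perm_def rv_eq
        by (auto simp: cube_map_apply sg_def transpose_def)
    qed
  qed (simp add: rot_def signed_perm_def cube_map_def)
qed

abbreviation gens where "gens \<equiv> {rot n d i j | i j. i \<in> I \<and> j \<in> I \<and> i \<noteq> j}"

lemma rot_group_carrier: "carrier (rot_group n d) = generate (BijGroup C) gens"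
  by (simp add: rot_group_def)

text \<open>A generator is a transposition with one sign, so both parities are odd. Both are
  additive under composition, since pulling a sign set back along a permutation keeps its
  size.\<close>

lemma rot_group_parity:
  assumes "f \<in> carrier (rot_group n d)"
  shows "\<exists>s B. s permutes I \<and> B \<subseteq> I \<and> f = signed_perm s B \<and> evenperm s = even (card B)"
proof -
  have gen: "\<exists>s B. s permutes I \<and> B \<subseteq> I \<and> h = signed_perm s B \<and> evenperm s = even (card B)" if h: "h \<in> gens" for h
  proof -
    obtain i j where ij: "i \<in> I" "j \<in> I" "i \<noteq> j" "h = rot n d i j" using h by blast
    show ?thesis
      by (rule exI[of _ "transpose i j"], rule exI[of _ "{i}"])
         (use ij rot_eq_signed_perm in \<open>simp add: permutes_swap_id evenperm_swap\<close>)
  qed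
  from assms[unfolded rot_group_carrier] show ?thesis
  proof induction
    case one
    show ?case using signed_perm_id permutes_id[of I] evenperm_id by (metis card.empty empty_subsetI even_zero)
  next
    case (incl h)
    then show ?case by (rule gen)
  next
    case (inv h)
    then obtain i j where ij: "i \<in> I" "j \<in> I" "i \<noteq> j" "h = rot n d i j" by blast
    have p: "transpose i j permutes I" "transpose j i permutes I" using ij by (simp_all add: permutes_swap_id)
    have e: "sdiff {j} {k \<in> I. transpose j i k \<in> {i}} = {}"
      using ij by (auto simp: sdiff_def transpose_def)
    \<comment> \<open>The inverse of a generator is the generator with the two indices
      exchanged.\<close>
    have "rot n d j i \<otimes>\<^bsub>BijGroup C\<^esub> h = \<one>\<^bsub>BijGroup C\<^esub>"
      using ij rot_eq_signed_perm signed_perm_mult[OF p(2,1), of "{j}" "{i}"] e by (simp add: signed_perm_id transpose_commute)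
    moreover have "h \<in> carrier (BijGroup C)" "rot n d j i \<in> carrier (BijGroup C)"
      using ij rot_in_Bij by (auto simp: BijGroup_def)
    ultimately have "inv\<^bsub>BijGroup C\<^esub> h = rot n d j i" by (intro group.inv_equality[OF group_BijGroup])
    moreover have "rot n d j i \<in> gens" using ij by blast
    ultimately show ?case by (simp only: gen)
  next
    case (eng h1 h2)
    then obtain s B s' B' where s: "s permutes I" "B \<subseteq> I" "h1 = signed_perm s B" "evenperm s = even (card B)"
      "s' permutes I" "B' \<subseteq> I" "h2 = signed_perm s' B'" "evenperm s' = even (card B')" by blast
    let ?D = "{i \<in> I. s i \<in> B'}"
    have "s ` ?D = B'"
    proof
      show "B' \<subseteq> s ` ?D"
      proof
        fix j assume j: "j \<in> B'"
        then obtain i where "i \<in> I" "j = s i" using permutes_image[OF s(1)] s(6) by (metis imageE subsetD)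
        then show "j \<in> s ` ?D" using j by blast
      qed
    qed blast
    moreover have "inj_on s ?D" using permutes_inj[OF s(1)] by (rule inj_on_subset) auto
    ultimately have cD: "card ?D = card B'" by (metis card_image)
    have fin: "finite B" using s(2) by (rule finite_subset) simp
    have perm: "permutation s" "permutation s'" using s(1,5) by (auto intro: permutes_imp_permutation[OF finite_atLeastAtMost])
    have "evenperm (s' \<circ> s) = even (card (sdiff B ?D))"
      using even_card_sdiff[OF fin, of ?D] cD s(4,8) evenperm_comp[OF perm(2,1)] by auto
    moreover have "s' \<circ> s permutes I" using s permutes_compose by blast
    moreover have "sdiff B ?D \<subseteq> I" using s(2) by (auto simp: sdiff_def)
    moreover have "h1 \<otimes>\<^bsub>BijGroup C\<^esub> h2 = signed_perm (s' \<circ> s) (sdiff B ?D)"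
      unfolding s(3,7) by (rule signed_perm_mult[OF s(1,5)])
    ultimately show ?case by metis
  qed
qed

lemma rot_group_mult:
  "f \<in> carrier (rot_group n d) \<Longrightarrow> g \<in> carrier (rot_group n d) \<Longrightarrow>
    f \<otimes>\<^bsub>BijGroup C\<^esub> g \<in> carrier (rot_group n d)"
  unfolding rot_group_carrier by (rule generate.eng)

lemma rot_in_rot_group:
  "i \<in> I \<Longrightarrow> j \<in> I \<Longrightarrow> i \<noteq> j \<Longrightarrow> signed_perm (transpose i j) {i} \<in> carrier (rot_group n d)"
  unfolding rot_group_carrier using rot_eq_signed_perm by (intro generate.incl) (metis (mono_tags, lifting) mem_Collect_eq)

lemma rot_group_perm:
  assumes "s permutes I"
  shows "\<exists>B\<subseteq>I. signed_perm s B \<in> carrier (rot_group n d)"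
  using assms finite_atLeastAtMost
proof (induction rule: permutes_induct)
  case id
  have "signed_perm id {} \<in> carrier (rot_group n d)"
    unfolding rot_group_carrier signed_perm_id by (rule generate.one)
  then show ?case unfolding id_def by blast
next
  case (swap a b s)
  then obtain B where B: "B \<subseteq> I" "signed_perm s B \<in> carrier (rot_group n d)" by blast
  have p: "transpose a b permutes I" using swap by (simp add: permutes_swap_id)
  have "signed_perm (transpose a b \<circ> s) (sdiff B {i \<in> I. s i \<in> {a}}) \<in> carrier (rot_group n d)"
    using rot_group_mult[OF B(2) rot_in_rot_group[OF swap(1-3)]] signed_perm_mult[OF \<open>s permutes I\<close> p] by simp
  moreover have "sdiff B {i \<in> I. s i \<in> {a}} \<subseteq> I" using B by (auto simp: sdiff_def)
  ultimately show ?case by blast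
qed

text \<open>The square of the rotation in the coordinates 1 and \<open>i\<close> reverses exactly
  these two. Hence the sign at any other coordinate can be changed at the price of the sign at
  coordinate 1.\<close>

lemma rot_group_flip:
  assumes s: "s permutes I" and B: "B \<subseteq> I" "signed_perm s B \<in> carrier (rot_group n d)" and i: "i \<in> I" "i \<noteq> 1"
  shows "signed_perm s (sdiff {1, i} B) \<in> carrier (rot_group n d)"
proof -
  have p: "transpose 1 i permutes I" using i one_in_I by (simp add: permutes_swap_id)
  have e: "sdiff {1} {k \<in> I. transpose 1 i k \<in> {1}} = {1, i}"
    using i one_in_I by (auto simp: sdiff_def transpose_def)
  note r = rot_in_rot_group[OF one_in_I i(1) i(2)[symmetric]]
  have "signed_perm id {1, i} \<in> carrier (rot_group n d)"
    using rot_group_mult[OF r r] signed_perm_mult[OF p p, of "{1}" "{1}"] e by simp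
  then have "signed_perm (s \<circ> id) (sdiff {1, i} {k \<in> I. id k \<in> B}) \<in> carrier (rot_group n d)"
    using rot_group_mult[OF _ B(2)] signed_perm_mult[OF permutes_id s] by metis
  moreover have "{k \<in> I. id k \<in> B} = B" using B(1) by auto
  ultimately show ?thesis by simp
qed

text \<open>Starting from some rotation with permutation \<open>s\<close>, the signs are corrected
  one coordinate at a time; \<open>D\<close> in the induction is the set of coordinates, other than
  1, flipped so far.\<close>

lemma rot_group_signs:
  assumes s: "s permutes I" and B: "B \<in> signs"
  shows "\<exists>B'\<subseteq>I. B' - {1} = B \<and> signed_perm s B' \<in> carrier (rot_group n d)"
proof -
  obtain B0 where B0: "B0 \<subseteq> I" "signed_perm s B0 \<in> carrier (rot_group n d)" using rot_group_perm[OF s] by blast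
  have "\<exists>B'\<subseteq>I. B' - {1} = sdiff D (B0 - {1}) \<and> signed_perm s B' \<in> carrier (rot_group n d)"
    if "finite D" "D \<subseteq> I - {1}" for D
    using that
  proof (induction D rule: finite_induct)
    case empty
    then show ?case using B0 by (intro exI[of _ B0]) (auto simp: sdiff_def)
  next
    case (insert i D)
    then obtain B' where B': "B' \<subseteq> I" "B' - {1} = sdiff D (B0 - {1})" "signed_perm s B' \<in> carrier (rot_group n d)" by blast
    have i: "i \<in> I" "i \<noteq> 1" using insert by auto
    have "sdiff {1, i} B' - {1} = sdiff {i} (B' - {1})" using i by (auto simp: sdiff_def)
    also have "\<dots> = sdiff (insert i D) (B0 - {1})" unfolding B'(2) using insert(2) by (auto simp: sdiff_def)
    finally have "sdiff {1, i} B' - {1} = sdiff (insert i D) (B0 - {1})" .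
    moreover have "sdiff {1, i} B' \<subseteq> I" using B'(1) i one_in_I by (auto simp: sdiff_def)
    ultimately show ?case using rot_group_flip[OF s B'(1,3) i] by blast
  qed
  moreover have D: "sdiff B (B0 - {1}) \<subseteq> I - {1}" using B B0(1) unfolding sdiff_def by blast
  moreover have "finite (sdiff B (B0 - {1}))" using D by (rule finite_subset) simp
  ultimately obtain B' where B': "B' \<subseteq> I" "signed_perm s B' \<in> carrier (rot_group n d)"
    "B' - {1} = sdiff (sdiff B (B0 - {1})) (B0 - {1})"
    by meson
  moreover have "sdiff (sdiff B (B0 - {1})) (B0 - {1}) = B" by (auto simp: sdiff_def)
  ultimately show ?thesis by auto
qed

lemma card_rot_group: "card (carrier (rot_group n d)) = card (perms \<times> signs)"
proof -
  define Q where "Q = {(s, B). s permutes I \<and> B \<subseteq> I \<and> signed_perm s B \<in> carrier (rot_group n d)}"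
  have "bij_betw (\<lambda>(s, B). signed_perm s B) Q (carrier (rot_group n d))"
  proof (rule bij_betw_imageI)
    show "inj_on (\<lambda>(s, B). signed_perm s B) Q"
    proof (rule inj_onI, clarify)
      fix s B s' B' assume "(s, B) \<in> Q" "(s', B') \<in> Q" and e: "signed_perm s B = signed_perm s' B'"
      then have "s permutes I" "s' permutes I" "B \<subseteq> I" "B' \<subseteq> I" by (simp_all add: Q_def)
      from signed_perm_eqD[OF this e] show "s = s' \<and> B = B'" by blast
    qed
    show "(\<lambda>(s, B). signed_perm s B) ` Q = carrier (rot_group n d)"
    proof (intro equalityI subsetI)
      fix f assume f: "f \<in> carrier (rot_group n d)"
      then obtain s B where "s permutes I" "B \<subseteq> I" "f = signed_perm s B" using rot_group_parity by blast
      then show "f \<in> (\<lambda>(s, B). signed_perm s B) ` Q" using f by (force simp: Q_def)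
    qed (auto simp: Q_def)
  qed
  then have "card (carrier (rot_group n d)) = card Q" using bij_betw_same_card by metis
  moreover have "bij_betw (\<lambda>(s, B). (s, B - {1})) Q (perms \<times> signs)"
  proof (rule bij_betw_imageI)
    \<comment> \<open>A signed permutation determines its sign set, so the parity condition holds
      for the given \<open>B\<close> and not just for some representation.\<close>
    have par: "evenperm s = even (card B)" if sB: "s permutes I" "B \<subseteq> I" "signed_perm s B \<in> carrier (rot_group n d)" for s B
    proof -
      obtain s' B' where "s' permutes I" "B' \<subseteq> I" "signed_perm s B = signed_perm s' B'" "evenperm s' = even (card B')"
        using rot_group_parity[OF sB(3)] by blast
      then show ?thesis using signed_perm_eqD sB by metis
    qed
    show "inj_on (\<lambda>(s, B). (s, B - {1})) Q"
    proof (rule inj_onI)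
      fix z w assume zw: "z \<in> Q" "w \<in> Q" "(\<lambda>(s, B). (s, B - {1})) z = (\<lambda>(s, B). (s, B - {1})) w"
      then obtain s B B' where z: "z = (s, B)" "w = (s, B')" and e: "B - {1} = B' - {1}" by (cases z, cases w) auto
      have Q: "(s, B) \<in> Q" "(s, B') \<in> Q" using zw z by auto
      have par2: "even (card B) = even (card B')" using par Q by (metis (no_types, lifting) Q_def case_prodD mem_Collect_eq)
      have fin: "finite B" "finite B'" using Q finite_subset[of _ I] by (auto simp: Q_def)
      have c: "card X = card (X - {1}) + (if 1 \<in> X then 1 else 0)" if "finite X" for X :: "nat set"
        using card.remove[OF that, of 1] by (auto simp: Diff_insert_absorb simp del: card_Diff_insert card_Diff_singleton_if card_Diff_singleton)
      have "card (B - {1}) = card (B' - {1})" using e by simp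
      \<comment> \<open>Equal signs off coordinate 1 together with equal parity of the total leave
        one choice at coordinate 1.\<close>
      then have "(1 \<in> B) = (1 \<in> B')" using c[OF fin(1)] c[OF fin(2)] par2
        by (cases "1 \<in> B"; cases "1 \<in> B'") presburger+
      then show "z = w" unfolding z using e by blast
    qed
    show "(\<lambda>(s, B). (s, B - {1})) ` Q = perms \<times> signs"
    proof (intro equalityI subsetI)
      fix z assume "z \<in> perms \<times> signs"
      then obtain s B where z: "z = (s, B)" "s permutes I" "B \<in> signs" by blast
      obtain B' where B': "B' \<subseteq> I" "B' - {1} = B" "signed_perm s B' \<in> carrier (rot_group n d)"
        using rot_group_signs[OF z(2,3)] by blast
      then have "(s, B') \<in> Q" using z by (simp add: Q_def)
      then show "z \<in> (\<lambda>(s, B). (s, B - {1})) ` Q" using z B' by force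
    qed (auto simp: Q_def)
  qed
  then have "card Q = card (perms \<times> signs)" by (rule bij_betw_same_card)
  ultimately show ?thesis by simp
qed

lemma order_line_group: "order (line_group n d) = order (rot_group n d) * order (coord_group n d)"
  using bij_betw_same_card[OF line_group_parametrization] card_rot_group card_coord_group
  by (simp add: order_def card_cartesian_product)

end

theorem theorem7:
  fixes n d :: nat
  assumes "n \<ge> 3" and "d \<ge> 2"
  shows "order (line_group n d) = order (rot_group n d) * order (coord_group n d)"
proof -
  interpret cube_lines n d using assms by unfold_locales
  show ?thesis by (rule order_line_group)
qed

end
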